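(* Let $(Y_n)_{n\ge0}$ be a hidden Markov model on a discrete (countable) space $S$ with recurrent underlying Markov chain. Then, for each $y\in S$, the row $(V_{y,n})_{n\ge1}$ of the successors array of $(Y_n)$ is a hidden Markov model (with values in $S^*=S\cup\{\partial\}$) with recurrent underlying Markov chain.
   Context: Successors array: let $\partial\notin S$ and $S^*=S\cup\{\partial\}$. For $y\in S$, $n\ge1$, $V_{y,n}$ is the value of $Y$ immediately following the $n$-th visit of $Y$ to $y$ (visits counted from time $0$). If $Y$ visits $y$ only $m<\infty$ times, $V_{y,n}=\partial$ for all $n>m$. Hidden Markov model (HMM): a sequence $(Z_n)_{n\ge n_0}$ with values in a discrete space $R$ ($n_0=0$ for $Y$, with $R=S$; $n_0=1$ for the rows $V_{y,\cdot}$, with $R=S^*$) is an HMM if there is a pair of processes $(X_n,\widetilde Z_n)_{n\ge n_0}$ with values in $\mathcal X\times R$, $\mathcal X$ a discrete (countable) space, such that (1) $(X_n)$ is a time homogeneous Markov chain on $\mathcal X$ (the underlying Markov chain); (2) for all $N\ge n_0$ and $S_{n_0},\dots,S_N\subseteq R$, $\mathbb P(\widetilde Z_{n_0}\in S_{n_0},\dots,\widetilde Z_N\in S_N\mid X_{n_0}^N=x_{n_0}^N)=\prod_{n=n_0}^N\mathbb P(\widetilde Z_n\in S_n\mid X_n=x_n)$, where the read-out distributions $f_x(\bar S)=\mathbb P(\widetilde Z_n\in\bar S\mid X_n=x)$ do not depend on $n$; (3) $(Z_n)$ and $(\widetilde Z_n)$ have the same finite-dimensional distributions. Recurrence: a time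 homogeneous Markov chain $(X_n)_{n\ge n_0}$ is recurrent if $\mathbb P(X_n=x\text{ for infinitely many }n\mid X_{n_0}=x)=1$ for all $x\in\mathcal X$ with $\mathbb P(X_{n_0}=x)>0$; such chains visit no transient states, but may have more than one recurrence class. *)

theory Defs
  imports "HOL-Probability.Probability"
begin

section \<open>Discrete-time processes with values in countable spaces\<close>

text \<open>Countable spaces are types of class \<open>countable\<close> with the discrete sigma-algebra. A process
  started at time \<open>n0\<close> is a function on all of \<^typ>\<open>nat\<close>; its values before \<open>n0\<close> are
  irrelevant.\<close>

definition discrete_process ::
    "'a measure \<Rightarrow> nat \<Rightarrow> (nat \<Rightarrow> 'a \<Rightarrow> 'x::countable) \<Rightarrow> bool" where
  "discrete_process M n0 X \<longleftrightarrow>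
     prob_space M \<and> (\<forall>n\<ge>n0. X n \<in> M \<rightarrow>\<^sub>M count_space UNIV)"

definition homogeneous_markov_chain ::
    "'a measure \<Rightarrow> nat \<Rightarrow> (nat \<Rightarrow> 'a \<Rightarrow> 'x::countable) \<Rightarrow> bool" where
  "homogeneous_markov_chain M n0 X \<longleftrightarrow>
     discrete_process M n0 X \<and>
     (\<exists>K :: 'x \<Rightarrow> 'x pmf. \<forall>n\<ge>n0. \<forall>x :: nat \<Rightarrow> 'x. \<forall>x'.
        \<P>(\<omega> in M. \<forall>k\<in>{n0..n}. X k \<omega> = x k) > 0 \<longrightarrow>
        \<P>(\<omega> in M. X (Suc n) \<omega> = x' \<bar> \<forall>k\<in>{n0..n}. X k \<omega> = x k) = pmf (K (x n)) x')"

definition recurrent_chain ::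
    "'a measure \<Rightarrow> nat \<Rightarrow> (nat \<Rightarrow> 'a \<Rightarrow> 'x::countable) \<Rightarrow> bool" where
  "recurrent_chain M n0 X \<longleftrightarrow>
     (\<forall>x. \<P>(\<omega> in M. X n0 \<omega> = x) > 0 \<longrightarrow>
        \<P>(\<omega> in M. infinite {n. n0 \<le> n \<and> X n \<omega> = x} \<bar> X n0 \<omega> = x) = 1)"

definition same_finite_dim_distributions ::
    "nat \<Rightarrow> 'a measure \<Rightarrow> (nat \<Rightarrow> 'a \<Rightarrow> 'r::countable) \<Rightarrow> 'b measure \<Rightarrow> (nat \<Rightarrow> 'b \<Rightarrow> 'r) \<Rightarrow> bool" where
  "same_finite_dim_distributions n0 M Z N Z' \<longleftrightarrow>
     (\<forall>J. finite J \<and> J \<subseteq> {n0..} \<longrightarrow>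
        distr M (Pi\<^sub>M J (\<lambda>_. count_space UNIV)) (\<lambda>\<omega>. \<lambda>n\<in>J. Z n \<omega>) =
        distr N (Pi\<^sub>M J (\<lambda>_. count_space UNIV)) (\<lambda>\<omega>. \<lambda>n\<in>J. Z' n \<omega>))"


section \<open>Hidden Markov models\<close>

text \<open>Conditional probabilities are only constrained when the conditioning event has positive
  probability. The kernel \<open>f\<close> collects the read-out distributions; that it does not depend on
  \<open>n\<close> is the time homogeneity of the read-out.\<close>

definition hidden_markov_pair ::
    "'a measure \<Rightarrow> nat \<Rightarrow> (nat \<Rightarrow> 'a \<Rightarrow> 'x::countable) \<Rightarrow> (nat \<Rightarrow> 'a \<Rightarrow> 'r::countable) \<Rightarrow> bool" where
  "hidden_markov_pair N n0 X Z \<longleftrightarrow>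
     homogeneous_markov_chain N n0 X \<and>
     discrete_process N n0 Z \<and>
     (\<forall>m\<ge>n0. \<forall>(A :: nat \<Rightarrow> 'r set) (x :: nat \<Rightarrow> 'x).
        \<P>(\<omega> in N. \<forall>n\<in>{n0..m}. X n \<omega> = x n) > 0 \<longrightarrow>
        \<P>(\<omega> in N. \<forall>n\<in>{n0..m}. Z n \<omega> \<in> A n \<bar> \<forall>n\<in>{n0..m}. X n \<omega> = x n) =
        (\<Prod>n=n0..m. \<P>(\<omega> in N. Z n \<omega> \<in> A n \<bar> X n \<omega> = x n))) \<and>
     (\<exists>f :: 'x \<Rightarrow> 'r pmf. \<forall>n\<ge>n0. \<forall>x B.
        \<P>(\<omega> in N. X n \<omega> = x) > 0 \<longrightarrow>
        \<P>(\<omega> in N. Z n \<omega> \<in> B \<bar> X n \<omega> = x) = measure_pmf.prob (f x) B)"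

text \<open>Existential quantification over types is not available, so the hidden state space is
  \<^typ>\<open>nat\<close> and the sample space of the pair is the type of its paths. Neither choice is a
  restriction: see \<open>recurrent_hidden_markov_modelI\<close> below.\<close>

definition recurrent_hidden_markov_model ::
    "'a measure \<Rightarrow> nat \<Rightarrow> (nat \<Rightarrow> 'a \<Rightarrow> 'r::countable) \<Rightarrow> bool" where
  "recurrent_hidden_markov_model M n0 Z \<longleftrightarrow>
     discrete_process M n0 Z \<and>
     (\<exists>(N :: (nat \<Rightarrow> nat \<times> 'r) measure) (X :: nat \<Rightarrow> _ \<Rightarrow> nat) Z'.
        hidden_markov_pair N n0 X Z' \<and> recurrent_chain N n0 X \<and>
        same_finite_dim_distributions n0 M Z N Z')"

lemma recurrent_hidden_markov_modelI:
  fixes M :: "'a measure" and Z :: "nat \<Rightarrow> 'a \<Rightarrow> 'r::countable"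
    and N :: "'b measure" and X :: "nat \<Rightarrow> 'b \<Rightarrow> 'x::countable" and Z' :: "nat \<Rightarrow> 'b \<Rightarrow> 'r"
  assumes Z: "discrete_process M n0 Z"
    and pair: "hidden_markov_pair N n0 X Z'"
    and rec: "recurrent_chain N n0 X"
    and fdd: "same_finite_dim_distributions n0 M Z N Z'"
  shows "recurrent_hidden_markov_model M n0 Z"
proof -
  let ?C = "Pi\<^sub>M UNIV (\<lambda>_. count_space UNIV) :: (nat \<Rightarrow> nat \<times> 'r) measure"
  define T where "T \<omega> n = (if n0 \<le> n then (to_nat (X n \<omega>), Z' n \<omega>) else undefined)" for \<omega> n
  define L where "L = distr N ?C T"
  define XX where "XX n p = fst (p n)" for n and p :: "nat \<Rightarrow> nat \<times> 'r"
  define ZZ where "ZZ n p = snd (p n)" for n and p :: "nat \<Rightarrow> nat \<times> 'r"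
  have chain: "homogeneous_markov_chain N n0 X" and Z': "discrete_process N n0 Z'"
    using pair by (auto simp: hidden_markov_pair_def)
  interpret N: prob_space N using Z' by (simp add: discrete_process_def)
  have Xm: "X n \<in> N \<rightarrow>\<^sub>M count_space UNIV" if "n0 \<le> n" for n
    using chain that by (simp add: homogeneous_markov_chain_def discrete_process_def)
  have Zm: "Z' n \<in> N \<rightarrow>\<^sub>M count_space UNIV" if "n0 \<le> n" for n
    using Z' that by (simp add: discrete_process_def)
  have T: "T \<in> N \<rightarrow>\<^sub>M ?C"
  proof (rule measurable_PiM_single')
    show "(\<lambda>\<omega>. T \<omega> n) \<in> N \<rightarrow>\<^sub>M count_space UNIV" for n
    proof (cases "n0 \<le> n")
      case True
      have "(\<lambda>\<omega>. (X n \<omega>, Z' n \<omega>)) \<in> N \<rightarrow>\<^sub>M (count_space UNIV \<Otimes>\<^sub>M count_space UNIV)"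
        using Xm[OF True] Zm[OF True] by simp
      then have *: "(\<lambda>\<omega>. (X n \<omega>, Z' n \<omega>)) \<in> N \<rightarrow>\<^sub>M count_space UNIV"
        by (simp add: pair_measure_countable)
      have "(\<lambda>p. (to_nat (fst p), snd p)) \<circ> (\<lambda>\<omega>. (X n \<omega>, Z' n \<omega>)) \<in> N \<rightarrow>\<^sub>M count_space UNIV"
        by (rule measurable_comp[OF *]) simp
      then show ?thesis using True by (simp add: T_def comp_def)
    qed (simp add: T_def)
  qed (simp add: PiE_def)
  have sp: "space L = UNIV" by (simp add: L_def space_PiM PiE_def)
  interpret L: prob_space L unfolding L_def by (rule N.prob_space_distr[OF T])
  have comp: "(\<lambda>p. p n) \<in> ?C \<rightarrow>\<^sub>M count_space UNIV" for n
    by (rule measurable_component_singleton) simp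
  have comp1: "XX n \<in> ?C \<rightarrow>\<^sub>M count_space UNIV" for n
    using measurable_comp[OF comp[of n], of fst "count_space UNIV"]
    by (simp add: XX_def[abs_def] comp_def)
  have comp2: "ZZ n \<in> ?C \<rightarrow>\<^sub>M count_space UNIV" for n
    using measurable_comp[OF comp[of n], of snd "count_space UNIV"]
    by (simp add: ZZ_def[abs_def] comp_def)
  note [measurable] = comp1 comp2
  have pr: "\<P>(p in L. P p) = \<P>(\<omega> in N. P (T \<omega>))" if "Measurable.pred ?C P" for P
  proof -
    have "{p \<in> space ?C. P p} \<in> sets ?C" using that by measurable
    then show ?thesis
      unfolding L_def by (subst measure_distr[OF T])
        (auto intro!: arg_cong[where f="measure N"] dest: measurable_space[OF T])
  qed
  have cpr: "\<P>(p in L. P p \<bar> Q p) = \<P>(\<omega> in N. P (T \<omega>) \<bar> Q (T \<omega>))"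
    if [measurable]: "Measurable.pred ?C P" "Measurable.pred ?C Q" for P Q
    unfolding cond_prob_def by (simp add: pr)
  have XT: "XX n (T \<omega>) = to_nat (X n \<omega>)" and ZT: "ZZ n (T \<omega>) = Z' n \<omega>" if "n0 \<le> n" for n \<omega>
    using that by (simp_all add: XX_def ZZ_def T_def)
  have pathX: "(\<forall>k\<in>{n0..n}. XX k (T \<omega>) = i k) \<longleftrightarrow> (\<forall>k\<in>{n0..n}. to_nat (X k \<omega>) = i k)" for n i \<omega>
    by (auto simp: XT)
  have pathZ: "(\<forall>k\<in>{n0..n}. ZZ k (T \<omega>) \<in> A k) \<longleftrightarrow> (\<forall>k\<in>{n0..n}. Z' k \<omega> \<in> A k)" for n A \<omega>
    by (auto simp: ZT)
  have decode: "\<exists>x. \<forall>k\<in>{n0..n}. i k = to_nat (x k :: 'x)"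
    if "\<P>(\<omega> in N. \<forall>k\<in>{n0..n}. to_nat (X k \<omega>) = i k) > 0" for n i
  proof -
    have "{\<omega> \<in> space N. \<forall>k\<in>{n0..n}. to_nat (X k \<omega>) = i k} \<noteq> {}"
      using that by (metis measure_empty less_irrefl)
    then obtain \<omega> where "\<forall>k\<in>{n0..n}. to_nat (X k \<omega>) = i k" by blast
    then show ?thesis by (intro exI[of _ "\<lambda>k. X k \<omega>"]) auto
  qed
  have pathx: "(\<forall>k\<in>{n0..n}. to_nat (X k \<omega>) = i k) \<longleftrightarrow> (\<forall>k\<in>{n0..n}. X k \<omega> = x k)"
    if "\<forall>k\<in>{n0..n}. i k = to_nat (x k)" for n i x \<omega>
    using that by auto
  have LX: "discrete_process L n0 XX" and LZ: "discrete_process L n0 ZZ"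
    unfolding discrete_process_def L_def
    using comp1 comp2 L.prob_space_axioms by (simp_all add: L_def)
  have "homogeneous_markov_chain L n0 XX"
  proof -
    obtain K where K: "\<And>n x x'. n0 \<le> n \<Longrightarrow> \<P>(\<omega> in N. \<forall>k\<in>{n0..n}. X k \<omega> = x k) > 0 \<Longrightarrow>
        \<P>(\<omega> in N. X (Suc n) \<omega> = x' \<bar> \<forall>k\<in>{n0..n}. X k \<omega> = x k) = pmf (K (x n)) x'"
      using chain unfolding homogeneous_markov_chain_def by blast
    have "\<P>(p in L. XX (Suc n) p = j \<bar> \<forall>k\<in>{n0..n}. XX k p = i k) =
        pmf (map_pmf to_nat (K (from_nat (i n)))) j"
      if n: "n0 \<le> n" and pos: "\<P>(p in L. \<forall>k\<in>{n0..n}. XX k p = i k) > 0" for n i j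
    proof -
      have pos': "\<P>(\<omega> in N. \<forall>k\<in>{n0..n}. to_nat (X k \<omega>) = i k) > 0"
        using pos by (subst (asm) pr) (simp_all add: pathX)
      then obtain x :: "nat \<Rightarrow> 'x" where x: "\<forall>k\<in>{n0..n}. i k = to_nat (x k)" using decode by blast
      have eq: "\<P>(p in L. XX (Suc n) p = j \<bar> \<forall>k\<in>{n0..n}. XX k p = i k) =
          \<P>(\<omega> in N. to_nat (X (Suc n) \<omega>) = j \<bar> \<forall>k\<in>{n0..n}. X k \<omega> = x k)"
        using n by (subst cpr) (simp_all add: pathX pathx[OF x] XT)
      have i: "from_nat (i n) = x n" using x n by simp
      show ?thesis
      proof (cases "j \<in> range (to_nat :: 'x \<Rightarrow> nat)")
        case True
        then obtain x' :: 'x where x': "j = to_nat x'" by blast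
        have "\<P>(\<omega> in N. X (Suc n) \<omega> = x' \<bar> \<forall>k\<in>{n0..n}. X k \<omega> = x k) = pmf (K (x n)) x'"
          using K[OF n] pos' by (simp add: pathx[OF x])
        then show ?thesis
          unfolding eq i unfolding x' by (simp add: pmf_map_inj')
      next
        case False
        then have "to_nat (X (Suc n) \<omega>) \<noteq> j" for \<omega> by auto
        moreover have "pmf (map_pmf to_nat (K (x n))) j = 0"
          using False by (auto simp: pmf_eq_0_set_pmf)
        ultimately show ?thesis
          unfolding eq i by (simp add: cond_prob_def)
      qed
    qed
    then show ?thesis
      unfolding homogeneous_markov_chain_def using LX
      by (intro conjI exI[of _ "\<lambda>i. map_pmf to_nat (K (from_nat i))"]) auto
  qed
  moreover have "\<P>(p in L. \<forall>n\<in>{n0..m}. ZZ n p \<in> A n \<bar> \<forall>n\<in>{n0..m}. XX n p = i n) =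
        (\<Prod>n=n0..m. \<P>(p in L. ZZ n p \<in> A n \<bar> XX n p = i n))"
    if m: "n0 \<le> m" and pos: "\<P>(p in L. \<forall>n\<in>{n0..m}. XX n p = i n) > 0" for m A i
  proof -
    have pos': "\<P>(\<omega> in N. \<forall>k\<in>{n0..m}. to_nat (X k \<omega>) = i k) > 0"
      using pos by (subst (asm) pr) (simp_all add: pathX)
    then obtain x :: "nat \<Rightarrow> 'x" where x: "\<forall>k\<in>{n0..m}. i k = to_nat (x k)" using decode by blast
    have "\<P>(p in L. \<forall>n\<in>{n0..m}. ZZ n p \<in> A n \<bar> \<forall>n\<in>{n0..m}. XX n p = i n) =
        \<P>(\<omega> in N. \<forall>n\<in>{n0..m}. Z' n \<omega> \<in> A n \<bar> \<forall>n\<in>{n0..m}. X n \<omega> = x n)"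
      by (subst cpr) (simp_all add: pathX pathZ pathx[OF x])
    also have "\<dots> = (\<Prod>n=n0..m. \<P>(\<omega> in N. Z' n \<omega> \<in> A n \<bar> X n \<omega> = x n))"
      using pair m pos' unfolding hidden_markov_pair_def by (simp add: pathx[OF x])
    also have "\<dots> = (\<Prod>n=n0..m. \<P>(p in L. ZZ n p \<in> A n \<bar> XX n p = i n))"
      using x by (intro prod.cong refl) (subst cpr, simp_all add: XT ZT)
    finally show ?thesis .
  qed
  moreover have "\<exists>f :: nat \<Rightarrow> 'r pmf. \<forall>n\<ge>n0. \<forall>i B. \<P>(p in L. XX n p = i) > 0 \<longrightarrow>
        \<P>(p in L. ZZ n p \<in> B \<bar> XX n p = i) = measure_pmf.prob (f i) B"
  proof -
    obtain f where f: "\<And>n x B. n0 \<le> n \<Longrightarrow> \<P>(\<omega> in N. X n \<omega> = x) > 0 \<Longrightarrow>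
        \<P>(\<omega> in N. Z' n \<omega> \<in> B \<bar> X n \<omega> = x) = measure_pmf.prob (f x) B"
      using pair unfolding hidden_markov_pair_def by blast
    have "\<P>(p in L. ZZ n p \<in> B \<bar> XX n p = i) = measure_pmf.prob (f (from_nat i)) B"
      if n: "n0 \<le> n" and pos: "\<P>(p in L. XX n p = i) > 0" for n i B
    proof -
      have pos': "\<P>(\<omega> in N. to_nat (X n \<omega>) = i) > 0"
        using pos n by (subst (asm) pr) (simp_all add: XT)
      then have "{\<omega> \<in> space N. to_nat (X n \<omega>) = i} \<noteq> {}" by (metis measure_empty less_irrefl)
      then obtain x :: 'x where x: "i = to_nat x" by blast
      show ?thesis
        using n f[OF n, of x B] pos' by (subst cpr) (simp_all add: XT ZT x)
    qed
    then show ?thesis by (intro exI[of _ "\<lambda>i. f (from_nat i)"]) auto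
  qed
  ultimately have "hidden_markov_pair L n0 XX ZZ"
    unfolding hidden_markov_pair_def using LZ by blast
  moreover have "recurrent_chain L n0 XX"
    unfolding recurrent_chain_def
  proof (intro allI impI)
    fix i assume pos: "\<P>(p in L. XX n0 p = i) > 0"
    have pos': "\<P>(\<omega> in N. to_nat (X n0 \<omega>) = i) > 0"
      using pos by (subst (asm) pr) (simp_all add: XT)
    then have "{\<omega> \<in> space N. to_nat (X n0 \<omega>) = i} \<noteq> {}" by (metis measure_empty less_irrefl)
    then obtain x :: 'x where x: "i = to_nat x" by blast
    have "{n. n0 \<le> n \<and> XX n (T \<omega>) = i} = {n. n0 \<le> n \<and> X n \<omega> = x}" for \<omega>
      by (auto simp: XT x)
    moreover have "Measurable.pred ?C (\<lambda>p. infinite {n. n0 \<le> n \<and> XX n p = i})"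
      unfolding infinite_nat_iff_unbounded_le mem_Collect_eq by measurable
    ultimately show "\<P>(p in L. infinite {n. n0 \<le> n \<and> XX n p = i} \<bar> XX n0 p = i) = 1"
      using rec pos' unfolding recurrent_chain_def
      by (subst cpr) (simp_all add: XT x)
  qed
  moreover have "same_finite_dim_distributions n0 M Z L ZZ"
    unfolding same_finite_dim_distributions_def
  proof (intro allI impI)
    fix J :: "nat set" assume J: "finite J \<and> J \<subseteq> {n0..}"
    have "distr L (Pi\<^sub>M J (\<lambda>_. count_space UNIV)) (\<lambda>p. \<lambda>n\<in>J. ZZ n p) =
        distr N (Pi\<^sub>M J (\<lambda>_. count_space UNIV)) ((\<lambda>p. \<lambda>n\<in>J. ZZ n p) \<circ> T)"
      unfolding L_def by (rule distr_distr[OF _ T]) (intro measurable_restrict comp2)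
    also have "(\<lambda>p. \<lambda>n\<in>J. ZZ n p) \<circ> T = (\<lambda>\<omega>. \<lambda>n\<in>J. Z' n \<omega>)"
      using J by (auto simp: fun_eq_iff ZT restrict_def)
    finally have L: "distr L (Pi\<^sub>M J (\<lambda>_. count_space UNIV)) (\<lambda>p. \<lambda>n\<in>J. ZZ n p) =
        distr N (Pi\<^sub>M J (\<lambda>_. count_space UNIV)) (\<lambda>\<omega>. \<lambda>n\<in>J. Z' n \<omega>)" .
    show "distr M (Pi\<^sub>M J (\<lambda>_. count_space UNIV)) (\<lambda>\<omega>. \<lambda>n\<in>J. Z n \<omega>) =
        distr L (Pi\<^sub>M J (\<lambda>_. count_space UNIV)) (\<lambda>p. \<lambda>n\<in>J. ZZ n p)"
      unfolding L using fdd J unfolding same_finite_dim_distributions_def by blast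
  qed
  ultimately show ?thesis
    unfolding recurrent_hidden_markov_model_def using Z by blast
qed


section \<open>The successors array\<close>

text \<open>\<^const>\<open>None\<close> plays the role of the extra point. The function \<^const>\<open>enumerate\<close> counts
  from 0, so the \<open>n\<close>-th visit (\<open>n \<ge> 1\<close>) has index \<open>n - 1\<close>; the value at \<open>n = 0\<close> is
  irrelevant.\<close>

definition successor :: "(nat \<Rightarrow> 's) \<Rightarrow> 's \<Rightarrow> nat \<Rightarrow> 's option" where
  "successor u y n =
     (let visits = {k. u k = y} in
      if finite visits \<and> card visits < n then None
      else Some (u (Suc (enumerate visits (n - 1)))))"

definition successors_array :: "(nat \<Rightarrow> 'a \<Rightarrow> 's) \<Rightarrow> 's \<Rightarrow> nat \<Rightarrow> 'a \<Rightarrow> 's option" where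
  "successors_array Y y n \<omega> = successor (\<lambda>k. Y k \<omega>) y n"

end

theory Submission
  imports Defs
begin

text \<open>Pair each hidden state with the read-out of the previous step: \<open>W n = (Z (n - 1), X n)\<close> is a
  Markov chain, and the visits of \<open>Z\<close> to \<open>y\<close> are, one step later, the visits of \<open>W\<close> to the set \<open>D\<close>
  of pairs with first component \<open>y\<close>. By the strong Markov property the values of \<open>W\<close> immediately
  after its successive visits to \<open>D\<close> (with an absorbing extra state if there are no more visits) form
  a Markov chain \<open>U\<close>, and the row of the successors array is a function of \<open>U\<close>.

  For recurrence, \<open>X\<close> returns to its initial state infinitely often. Every step that \<open>W\<close> actually
  makes has positive probability, and a step with probability bounded below on a set visited
  infinitely often is itself made infinitely often. Hence, along almost every path, each step made
  after the first one recurs infinitely often; this includes the step out of the first visit to \<open>D\<close>.\<close>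

section \<open>Laws of Markov chains on path space\<close>

abbreviation path_space :: "(nat \<Rightarrow> 'w::countable) measure" where
  "path_space \<equiv> Pi\<^sub>M UNIV (\<lambda>_. count_space UNIV)"

lemma space_path_space [simp]: "space path_space = UNIV"
  by (simp add: space_PiM PiE_def)

lemma path_space_component [measurable]: "(\<lambda>u. u n) \<in> path_space \<rightarrow>\<^sub>M count_space UNIV"
  by (rule measurable_component_singleton) simp

lemma measurable_into_path_space:
  assumes "\<And>n. (\<lambda>\<omega>. F \<omega> n) \<in> M \<rightarrow>\<^sub>M count_space UNIV"
  shows "F \<in> M \<rightarrow>\<^sub>M path_space"
  by (rule measurable_PiM_single') (use assms in \<open>auto simp: PiE_def\<close>)

lemma pred_sets: "Measurable.pred path_space H \<Longrightarrow> {u. H u} \<in> sets path_space"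
  by (drule predE) simp

section \<open>Countable additivity over fibres\<close>

text \<open>Countable additivity over the values of \<open>f\<close> reduces the inequality to its
  fibres. The sum is an integral against counting measure in the extended reals, so no summability
  has to be checked. In the applications \<open>f\<close> is a prefix, a current state or a visit
  time.\<close>

lemma measure_fibrewise_mono:
  fixes f :: "'a \<Rightarrow> 'i::countable"
  assumes L: "finite_measure L" "finite_measure L'"
    and A: "{u \<in> space L. A u} \<in> sets L" and B: "{u \<in> space L'. B u} \<in> sets L'"
    and f: "f \<in> L \<rightarrow>\<^sub>M count_space UNIV" "f \<in> L' \<rightarrow>\<^sub>M count_space UNIV"
    and pq: "0 \<le> p" "0 \<le> q"
    and le: "\<And>c. p * measure L {u \<in> space L. A u \<and> f u = c} \<le> q * measure L' {u \<in> space L'. B u \<and> f u = c}"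
  shows "p * measure L {u \<in> space L. A u} \<le> q * measure L' {u \<in> space L'. B u}"
proof -
  interpret L: finite_measure L by fact
  interpret L': finite_measure L' by fact
  have fib: "emeasure K {u \<in> space K. C u} = (\<integral>\<^sup>+c. emeasure K {u \<in> space K. C u \<and> f u = c} \<partial>count_space UNIV)"
    if C[measurable]: "{u \<in> space K. C u} \<in> sets K" and f[measurable]: "f \<in> K \<rightarrow>\<^sub>M count_space UNIV" for K C
  proof -
    have "{u \<in> space K. C u} = (\<Union>c. {u \<in> space K. C u \<and> f u = c})" by auto
    then show ?thesis
      by (simp only:, intro emeasure_UN_countable) (auto simp: disjoint_family_on_def)
  qed
  have "ennreal p * emeasure L {u \<in> space L. A u} =
      (\<integral>\<^sup>+c. ennreal p * emeasure L {u \<in> space L. A u \<and> f u = c} \<partial>count_space UNIV)"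
    by (subst fib[OF A f(1)]) (simp add: nn_integral_cmult)
  also have "\<dots> \<le> (\<integral>\<^sup>+c. ennreal q * emeasure L' {u \<in> space L'. B u \<and> f u = c} \<partial>count_space UNIV)"
    using le pq by (intro nn_integral_mono)
      (simp add: L.emeasure_eq_measure L'.emeasure_eq_measure flip: ennreal_mult)
  also have "\<dots> = ennreal q * emeasure L' {u \<in> space L'. B u}"
    by (subst fib[OF B f(2)]) (simp add: nn_integral_cmult)
  finally show ?thesis
    using pq by (simp add: L.emeasure_eq_measure L'.emeasure_eq_measure flip: ennreal_mult)
qed

lemma measure_fibrewise_eq:
  fixes f :: "'a \<Rightarrow> 'i::countable"
  assumes "finite_measure L" "finite_measure L'"
    and "{u \<in> space L. A u} \<in> sets L" and "{u \<in> space L'. B u} \<in> sets L'"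
    and "f \<in> L \<rightarrow>\<^sub>M count_space UNIV" "f \<in> L' \<rightarrow>\<^sub>M count_space UNIV"
    and "0 \<le> q"
    and "\<And>c. measure L {u \<in> space L. A u \<and> f u = c} = q * measure L' {u \<in> space L'. B u \<and> f u = c}"
  shows "measure L {u \<in> space L. A u} = q * measure L' {u \<in> space L'. B u}"
  using measure_fibrewise_mono[of L L' A B f 1 q] measure_fibrewise_mono[of L' L B A f q 1] assms
  by auto

section \<open>Events determined by a finite prefix\<close>

text \<open>Events of the past up to time \<open>n\<close>, encoded as invariance under changes
  after time \<open>n\<close>: this is easy to verify for explicit events, and measurability follows
  from countability of the state space.\<close>

definition prefix_determined :: "nat \<Rightarrow> ((nat \<Rightarrow> 'w) \<Rightarrow> bool) \<Rightarrow> bool" where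
  "prefix_determined n H \<longleftrightarrow> (\<forall>u v. (\<forall>k\<le>n. u k = v k) \<longrightarrow> H u = H v)"

lemma prefix_determinedD: "prefix_determined n H \<Longrightarrow> (\<And>k. k \<le> n \<Longrightarrow> u k = v k) \<Longrightarrow> H u = H v"
  by (auto simp: prefix_determined_def)

lemma prefix_measurable [measurable]:
  "(\<lambda>u. map u [0..<n]) \<in> path_space \<rightarrow>\<^sub>M count_space (UNIV :: 'w::countable list set)"
proof (induction n)
  case (Suc n)
  have "(\<lambda>u :: nat \<Rightarrow> 'w. (map u [0..<n], u n)) \<in> path_space \<rightarrow>\<^sub>M count_space UNIV \<Otimes>\<^sub>M count_space UNIV"
    using Suc by measurable
  then have *: "(\<lambda>u :: nat \<Rightarrow> 'w. (map u [0..<n], u n)) \<in> path_space \<rightarrow>\<^sub>M count_space UNIV"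
    by (simp add: pair_measure_countable)
  have "(\<lambda>p. fst p @ [snd p]) \<circ> (\<lambda>u :: nat \<Rightarrow> 'w. (map u [0..<n], u n)) \<in> path_space \<rightarrow>\<^sub>M count_space UNIV"
    by (rule measurable_comp[OF *]) simp
  then show ?case by (simp add: comp_def)
qed simp

lemma prefix_eq_iff: "map u [0..<Suc n] = map v [0..<Suc n] \<longleftrightarrow> (\<forall>k\<le>n. u k = v k)"
  by (auto simp: less_Suc_eq_le simp del: upt_Suc)

text \<open>\<open>H\<close> factors through the prefix map, whose target, lists over a countable
  type, carries the discrete sigma-algebra.\<close>

lemma prefix_determined_measurable:
  fixes H :: "(nat \<Rightarrow> 'w::countable) \<Rightarrow> bool"
  assumes "prefix_determined n H"
  shows "Measurable.pred path_space H"
proof -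
  have "H u \<longleftrightarrow> map u [0..<Suc n] \<in> {map v [0..<Suc n] |v. H v}" for u
    using prefix_determinedD[OF assms, of u] unfolding mem_Collect_eq prefix_eq_iff by blast
  then have "H = (\<lambda>u. map u [0..<Suc n] \<in> {map v [0..<Suc n] |v. H v})" by blast
  moreover have "Measurable.pred path_space (\<lambda>u. map u [0..<Suc n] \<in> {map v [0..<Suc n] |v. H v})"
    by (rule measurable_compose[OF prefix_measurable]) simp
  ultimately show ?thesis by (simp only:)
qed

section \<open>Markov laws and their uniqueness\<close>

text \<open>The Markov property is a product formula on cylinders instead of a conditional
  probability, so null conditioning events need no separate case. The initial distribution is left
  free, so that conditional laws of later parts of the path satisfy the same predicate.\<close>

definition markov_law :: "('w::countable \<Rightarrow> 'w pmf) \<Rightarrow> (nat \<Rightarrow> 'w) measure \<Rightarrow> bool" where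
  "markov_law Q L \<longleftrightarrow> prob_space L \<and> sets L = sets path_space \<and>
     (\<forall>n v. measure L {u. \<forall>k\<le>Suc n. u k = v k} =
        measure L {u. \<forall>k\<le>n. u k = v k} * pmf (Q (v n)) (v (Suc n)))"

locale markov_path_law =
  fixes Q :: "'w::countable \<Rightarrow> 'w pmf" and L :: "(nat \<Rightarrow> 'w) measure"
  assumes law: "markov_law Q L"

sublocale markov_path_law \<subseteq> prob_space L
  using law by (simp add: markov_law_def)

context markov_path_law
begin

lemma sets_L [measurable_cong, simp]: "sets L = sets path_space"
  using law by (simp add: markov_law_def)

lemma space_L [simp]: "space L = UNIV"
  using sets_eq_imp_space_eq[OF sets_L] by simp

lemma measurable_L [simp]: "measurable L K = measurable path_space K"
  by (rule measurable_cong_sets) simp_all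

text \<open>The past event is cut by the prefix of length \<open>Suc n\<close>: each piece is empty
  or a single cylinder, where the defining identity applies.\<close>

lemma markov_step:
  assumes H: "prefix_determined n H"
  shows "prob {u. H u \<and> u n = x \<and> u (Suc n) = x'} = prob {u. H u \<and> u n = x} * pmf (Q x) x'"
proof -
  have [measurable]: "Measurable.pred path_space H"
    by (rule prefix_determined_measurable[OF H])
  have fib: "prob {u. (H u \<and> u n = x \<and> u (Suc n) = x') \<and> map u [0..<Suc n] = c} =
        pmf (Q x) x' * prob {u. (H u \<and> u n = x) \<and> map u [0..<Suc n] = c}" for c
  proof (cases "\<exists>v. H v \<and> v n = x \<and> map v [0..<Suc n] = c")
    case True
    then obtain v where v: "H v" "v n = x" "map v [0..<Suc n] = c" by blast
    have Hv: "H u" if "\<forall>k\<le>n. u k = v k" for u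
      using prefix_determinedD[OF H, of u v] that v by simp
    \<comment> \<open>The witness is overwritten by \<open>x'\<close> at time \<open>Suc n\<close>,
      so that one function describes both cylinders.\<close>
    have 1: "{u. (H u \<and> u n = x) \<and> map u [0..<Suc n] = c} = {u. \<forall>k\<le>n. u k = (v(Suc n := x')) k}"
      using v(2) Hv unfolding v(3)[symmetric] prefix_eq_iff by auto
    have 2: "{u. (H u \<and> u n = x \<and> u (Suc n) = x') \<and> map u [0..<Suc n] = c} =
        {u. \<forall>k\<le>Suc n. u k = (v(Suc n := x')) k}"
      using v(2) Hv unfolding v(3)[symmetric] prefix_eq_iff by (auto simp: le_Suc_eq)
    have "prob {u. \<forall>k\<le>Suc n. u k = (v(Suc n := x')) k} =
        prob {u. \<forall>k\<le>n. u k = (v(Suc n := x')) k} * pmf (Q ((v(Suc n := x')) n)) ((v(Suc n := x')) (Suc n))"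
      using law unfolding markov_law_def by blast
    then show ?thesis unfolding 1 2 using v(2) by simp
  next
    case False
    then have "{u. (H u \<and> u n = x \<and> u (Suc n) = x') \<and> map u [0..<Suc n] = c} = {}"
      "{u. (H u \<and> u n = x) \<and> map u [0..<Suc n] = c} = {}" by blast+
    then show ?thesis by (simp only: measure_empty)
  qed
  have "prob {u \<in> space L. H u \<and> u n = x \<and> u (Suc n) = x'} = pmf (Q x) x' * prob {u \<in> space L. H u \<and> u n = x}"
  proof (rule measure_fibrewise_eq[OF finite_measure_axioms finite_measure_axioms])
    show "prob {u \<in> space L. (H u \<and> u n = x \<and> u (Suc n) = x') \<and> map u [0..<Suc n] = c} =
        pmf (Q x) x' * prob {u \<in> space L. (H u \<and> u n = x) \<and> map u [0..<Suc n] = c}" for c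
      using fib[of c] by (simp only: space_L UNIV_I simp_thms)
  qed (simp_all add: pred_sets del: upt_Suc)
  then show ?thesis by (simp add: mult.commute)
qed

text \<open>Iterates \<open>markov_step\<close>: the past \<open>H\<close> together with the word
  read so far is again determined by the prefix up to \<open>n + j\<close>.\<close>

lemma markov_word:
  assumes H: "prefix_determined n H"
  shows "prob {u. H u \<and> (\<forall>k\<le>j. u (n + k) = v k)} =
    prob {u. H u \<and> u n = v 0} * (\<Prod>k<j. pmf (Q (v k)) (v (Suc k)))"
proof (induction j)
  case (Suc j)
  have "prefix_determined (n + j) (\<lambda>u. H u \<and> (\<forall>k\<le>j. u (n + k) = v k))"
    unfolding prefix_determined_def
  proof (intro allI impI)
    fix u u' :: "nat \<Rightarrow> 'w" assume *: "\<forall>k\<le>n + j. u k = u' k"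
    then have "H u = H u'" by (intro prefix_determinedD[OF H]) simp
    then show "(H u \<and> (\<forall>k\<le>j. u (n + k) = v k)) = (H u' \<and> (\<forall>k\<le>j. u' (n + k) = v k))"
      using * by simp
  qed
  from markov_step[OF this, of "v j" "v (Suc j)"]
  moreover have "{u. H u \<and> (\<forall>k\<le>Suc j. u (n + k) = v k)} =
      {u. (H u \<and> (\<forall>k\<le>j. u (n + k) = v k)) \<and> u (n + j) = v j \<and> u (Suc (n + j)) = v (Suc j)}"
    "{u. H u \<and> (\<forall>k\<le>j. u (n + k) = v k)} = {u. (H u \<and> (\<forall>k\<le>j. u (n + k) = v k)) \<and> u (n + j) = v j}"
    by (auto simp: le_Suc_eq)
  ultimately have "prob {u. H u \<and> (\<forall>k\<le>Suc j. u (n + k) = v k)} =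
      prob {u. H u \<and> (\<forall>k\<le>j. u (n + k) = v k)} * pmf (Q (v j)) (v (Suc j))"
    by simp
  then show ?case using Suc by simp
qed simp

lemma markov_cylinder:
  "prob {u. \<forall>k\<le>j. u k = v k} = prob {u. u 0 = v 0} * (\<Prod>k<j. pmf (Q (v k)) (v (Suc k)))"
  using markov_word[of 0 "\<lambda>_. True" j v] by (simp add: prefix_determined_def)

end

text \<open>Kernel and initial distribution fix all cylinder probabilities; summing over prefixes
  extends the agreement to events in finitely many coordinates, and finite-dimensional boxes
  determine a finite measure on the product.\<close>

lemma markov_law_unique:
  fixes L L' :: "(nat \<Rightarrow> 'w::countable) measure"
  assumes L: "markov_law Q L" and L': "markov_law Q L'"
    and init: "\<And>x. measure L {u. u 0 = x} = measure L' {u. u 0 = x}"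
  shows "L = L'"
proof -
  interpret L: markov_path_law Q L by standard fact
  interpret L': markov_path_law Q L' by standard fact
  have cyl: "L.prob {u. \<forall>k\<le>n. u k = v k} = L'.prob {u. \<forall>k\<le>n. u k = v k}" for n v
    unfolding L.markov_cylinder L'.markov_cylinder init ..
  have det: "L.prob {u. H u} = L'.prob {u. H u}" if H: "prefix_determined n H" for n H
  proof -
    have fib: "L.prob {u. H u \<and> map u [0..<Suc n] = c} = 1 * L'.prob {u. H u \<and> map u [0..<Suc n] = c}" for c
    proof (cases "\<exists>v. H v \<and> map v [0..<Suc n] = c")
      case True
      then obtain v where v: "H v" "map v [0..<Suc n] = c" by blast
      have "{u. H u \<and> map u [0..<Suc n] = c} = {u. \<forall>k\<le>n. u k = v k}"
        using v(1) prefix_determinedD[OF H, of _ v] unfolding v(2)[symmetric] prefix_eq_iff by blast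
      then show ?thesis using cyl by simp
    next
      case False
      then have "{u. H u \<and> map u [0..<Suc n] = c} = {}" by blast
      then show ?thesis by (simp only: measure_empty)
    qed
    have "L.prob {u \<in> space L. H u} = 1 * L'.prob {u \<in> space L'. H u}"
    proof (rule measure_fibrewise_eq[OF L.finite_measure_axioms L'.finite_measure_axioms])
      show "L.prob {u \<in> space L. H u \<and> map u [0..<Suc n] = c} =
          1 * L'.prob {u \<in> space L'. H u \<and> map u [0..<Suc n] = c}" for c
        using fib[of c] by (simp only: L.space_L L'.space_L UNIV_I simp_thms)
    qed (simp_all add: pred_sets prefix_determined_measurable[OF H] del: upt_Suc)
    then show ?thesis by simp
  qed
  show ?thesis
  proof (rule measure_eqI_PiM_infinite)
    show "sets L = sets path_space" "sets L' = sets path_space" by simp_all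
    show "finite_measure L" by (rule L.finite_measure_axioms)
    fix A :: "nat \<Rightarrow> 'w set" and J :: "nat set" assume J: "finite J"
    then obtain n where n: "\<forall>j\<in>J. j \<le> n" by (meson finite_nat_set_iff_bounded_le)
    have eq: "prod_emb UNIV (\<lambda>_. count_space UNIV) J (Pi\<^sub>E J A) = {u. \<forall>j\<in>J. u j \<in> A j}"
      by (auto simp: prod_emb_def PiE_def Pi_def extensional_def)
    have "prefix_determined n (\<lambda>u. \<forall>j\<in>J. u j \<in> A j)"
      using n by (auto simp: prefix_determined_def)
    from det[OF this]
    show "emeasure L (prod_emb UNIV (\<lambda>_. count_space UNIV) J (Pi\<^sub>E J A)) =
        emeasure L' (prod_emb UNIV (\<lambda>_. count_space UNIV) J (Pi\<^sub>E J A))"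
      unfolding eq by (simp add: L.emeasure_eq_measure L'.emeasure_eq_measure)
  qed
qed


section \<open>Transitions made infinitely often\<close>

context markov_path_law
begin

text \<open>A conditional Borel-Cantelli argument. The uniform bound \<open>\<delta>\<close> lets
  \<open>G\<close> be an infinite set of states, where infinitely many visits to \<open>G\<close>
  may be spread over states each visited only finitely often.\<close>

lemma AE_step_infinitely_often:
  assumes \<delta>: "0 < \<delta>" "\<And>x. x \<in> G \<Longrightarrow> \<delta> \<le> pmf (Q x) b"
  shows "AE u in L. infinite {n. u n \<in> G} \<longrightarrow> infinite {n. u n \<in> G \<and> u (Suc n) = b}"
proof (cases "G = {}")
  case False
  then have \<delta>1: "\<delta> \<le> 1" using \<delta>(2) pmf_le_1 order.trans by fast
  \<comment> \<open>\<open>B N k n\<close> says that the visit at time \<open>n\<close> was preceded by \<open>k\<close> unsuccessful visits since \<open>N\<close>;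
    each visit succeeds with conditional probability at least \<open>\<delta>\<close>, so \<open>\<exists>n. B N k n\<close> has probability
    at most \<open>(1 - \<delta>) ^ k\<close>.\<close>
  define B where "B N k n u \<longleftrightarrow> N \<le> n \<and> u n \<in> G \<and> card {j\<in>{N..<n}. u j \<in> G} = k \<and>
      (\<forall>j\<in>{N..<n}. u j \<in> G \<longrightarrow> u (Suc j) \<noteq> b)" for N k n and u :: "nat \<Rightarrow> 'w"
  have det: "prefix_determined n (B N k n)" for N k n
    unfolding prefix_determined_def
  proof (intro allI impI)
    fix u v :: "nat \<Rightarrow> 'w" assume *: "\<forall>k\<le>n. u k = v k"
    then have "{j\<in>{N..<n}. u j \<in> G} = {j\<in>{N..<n}. v j \<in> G}" by auto
    then show "B N k n u = B N k n v" using * by (auto simp: B_def)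
  qed
  note [measurable] = prefix_determined_measurable[OF det]
  have step: "prob {u. B N k n u \<and> u (Suc n) \<noteq> b} \<le> (1 - \<delta>) * prob {u. B N k n u}" for N k n
  proof -
    have fib: "\<delta> * prob {u. B N k n u \<and> u n = c} \<le> 1 * prob {u. (B N k n u \<and> u (Suc n) = b) \<and> u n = c}" for c
    proof (cases "c \<in> G")
      case True
      have "prob {u. (B N k n u \<and> u (Suc n) = b) \<and> u n = c} = prob {u. B N k n u \<and> u n = c} * pmf (Q c) b"
        using markov_step[OF det, of N k n c b] by (simp add: conj_ac)
      then show ?thesis using \<delta>(2)[OF True] by (simp add: mult.commute mult_right_mono)
    next
      case False
      then have "{u. B N k n u \<and> u n = c} = {}" by (auto simp: B_def)
      then show ?thesis by (simp only: measure_empty) simp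
    qed
    have "\<delta> * prob {u \<in> space L. B N k n u} \<le> 1 * prob {u \<in> space L. B N k n u \<and> u (Suc n) = b}"
    proof (rule measure_fibrewise_mono[OF finite_measure_axioms finite_measure_axioms])
      show "\<delta> * prob {u \<in> space L. B N k n u \<and> u n = c} \<le>
          1 * prob {u \<in> space L. (B N k n u \<and> u (Suc n) = b) \<and> u n = c}" for c
        using fib[of c] by (simp only: space_L UNIV_I simp_thms)
    qed (use \<delta>(1) in \<open>simp_all add: pred_sets\<close>)
    moreover have "{u. B N k n u \<and> u (Suc n) \<noteq> b} = {u. B N k n u} - {u. B N k n u \<and> u (Suc n) = b}"
      by blast
    then have "prob {u. B N k n u \<and> u (Suc n) \<noteq> b} = prob {u. B N k n u} - prob {u. B N k n u \<and> u (Suc n) = b}"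
      by (simp only:, intro finite_measure_Diff) (auto intro!: pred_sets)
    ultimately show ?thesis by (simp add: algebra_simps)
  qed
  have uniq: "n = n'" if "B N k n u" "B N k n' u" for N k n n' u
  proof -
    have False if B: "B N k n u" "B N k n' u" and lt: "n < n'" for n n'
    proof -
      have "{j\<in>{N..<n}. u j \<in> G} \<subset> {j\<in>{N..<n'}. u j \<in> G}" using B lt by (auto simp: B_def)
      then have "card {j\<in>{N..<n}. u j \<in> G} < card {j\<in>{N..<n'}. u j \<in> G}"
        by (intro psubset_card_mono) auto
      then show False using B by (auto simp: B_def)
    qed
    then show ?thesis using that by (meson linorder_neqE_nat)
  qed
  \<comment> \<open>The last visit to \<open>G\<close> before \<open>n'\<close> has exactly
    \<open>k\<close> predecessors since \<open>N\<close>, and \<open>B N (Suc k) n'\<close> demands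
    that it failed.\<close>
  have prev: "\<exists>n. B N k n u \<and> u (Suc n) \<noteq> b" if "B N (Suc k) n' u" for N k n' u
  proof -
    let ?J = "{j\<in>{N..<n'}. u j \<in> G}"
    have J: "finite ?J" "card ?J = Suc k" using that by (auto simp: B_def)
    then have "?J \<noteq> {}" by (metis card.empty nat.distinct(1))
    then have n: "Max ?J \<in> ?J" using J(1) by (intro Max_in)
    have lt: "j \<le> Max ?J" if "j \<in> ?J" for j using J that by (intro Max_ge) auto
    have "{j\<in>{N..<Max ?J}. u j \<in> G} = ?J - {Max ?J}"
      using n lt by (auto simp: less_le)
    then have "card {j\<in>{N..<Max ?J}. u j \<in> G} = k" using J n by simp
    then have "B N k (Max ?J) u \<and> u (Suc (Max ?J)) \<noteq> b"
      using n that unfolding B_def by auto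
    then show ?thesis by blast
  qed
  have decr: "prob {u. \<exists>n. B N (Suc k) n u} \<le> (1 - \<delta>) * prob {u. \<exists>n. B N k n u}" for N k
  proof -
    \<comment> \<open>If some \<open>n\<close> satisfies \<open>B N k n\<close>, it is unique, so
      the values of \<open>?f\<close> split the union over \<open>n\<close> into disjoint
      events.\<close>
    let ?f = "\<lambda>u. LEAST n. B N k n u"
    have f: "?f u = n" if "B N k n u" for u n
      by (rule uniq[OF LeastI[of "\<lambda>n. B N k n u", OF that] that])
    have fib: "1 * prob {u. (\<exists>n. B N k n u \<and> u (Suc n) \<noteq> b) \<and> ?f u = c} \<le>
        (1 - \<delta>) * prob {u. (\<exists>n. B N k n u) \<and> ?f u = c}" for c
    proof -
      have "{u. (\<exists>n. B N k n u \<and> u (Suc n) \<noteq> b) \<and> ?f u = c} = {u. B N k c u \<and> u (Suc c) \<noteq> b}"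
        "{u. (\<exists>n. B N k n u) \<and> ?f u = c} = {u. B N k c u}"
        using f by blast+
      then show ?thesis using step[of N k c] by (simp only: mult_1)
    qed
    have "prob {u. \<exists>n. B N (Suc k) n u} \<le> prob {u. \<exists>n. B N k n u \<and> u (Suc n) \<noteq> b}"
      by (rule finite_measure_mono) (use prev in \<open>auto intro!: pred_sets\<close>)
    moreover have "1 * prob {u \<in> space L. \<exists>n. B N k n u \<and> u (Suc n) \<noteq> b} \<le> (1 - \<delta>) * prob {u \<in> space L. \<exists>n. B N k n u}"
    proof (rule measure_fibrewise_mono[OF finite_measure_axioms finite_measure_axioms])
      show "1 * prob {u \<in> space L. (\<exists>n. B N k n u \<and> u (Suc n) \<noteq> b) \<and> ?f u = c} \<le>
        (1 - \<delta>) * prob {u \<in> space L. (\<exists>n. B N k n u) \<and> ?f u = c}" for c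
        using fib[of c] by (simp only: space_L UNIV_I simp_thms)
    qed (use \<delta>1 in \<open>simp_all add: pred_sets\<close>)
    ultimately show ?thesis by simp
  qed
  have bound: "prob {u. \<exists>n. B N k n u} \<le> (1 - \<delta>) ^ k" for N k
  proof (induction k)
    case (Suc k)
    then show ?case using decr[of N k] \<delta>1 by (simp add: mult_left_mono order.trans)
  qed simp
  have "AE u in L. \<not> (\<forall>k. \<exists>n. B N k n u)" for N
  proof -
    have "prob {u. \<forall>k. \<exists>n. B N k n u} \<le> (1 - \<delta>) ^ k" for k
      by (rule order.trans[OF _ bound[of N k]], rule finite_measure_mono) (auto intro!: pred_sets)
    then have "prob {u. \<forall>k. \<exists>n. B N k n u} \<le> 0"
      using \<delta>(1) \<delta>1 by (intro LIMSEQ_le_const[OF LIMSEQ_power_zero[of "1 - \<delta>"]]) auto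
    then have "prob {u. \<forall>k. \<exists>n. B N k n u} = 0" using measure_nonneg order.antisym by metis
    then show ?thesis by (subst (asm) prob_eq_0) (auto intro!: pred_sets)
  qed
  then have "AE u in L. \<forall>N. \<not> (\<forall>k. \<exists>n. B N k n u)" unfolding AE_all_countable by blast
  then show ?thesis
  proof (rule AE_mp, intro AE_I2 impI notI)
    fix u assume no: "\<forall>N. \<not> (\<forall>k. \<exists>n. B N k n u)" and inf: "infinite {n. u n \<in> G}"
      and fin: "finite {n. u n \<in> G \<and> u (Suc n) = b}"
    \<comment> \<open>Counting starts at an \<open>N\<close> beyond the last success, so every visit
      from then on fails and \<open>B N k n\<close> is met for every \<open>k\<close>.\<close>
    from fin obtain N where N: "\<forall>n\<in>{n. u n \<in> G \<and> u (Suc n) = b}. n < N"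
      by (meson finite_nat_set_iff_bounded)
    have next_visit: "\<exists>n'\<ge>n. u n' \<in> G \<and> (\<forall>j\<in>{n..<n'}. u j \<notin> G)" for n
    proof -
      have ex: "\<exists>n'. n \<le> n' \<and> u n' \<in> G" using inf by (auto simp: infinite_nat_iff_unbounded_le)
      show ?thesis
        by (rule exI[of _ "LEAST n'. n \<le> n' \<and> u n' \<in> G"])
          (use LeastI_ex[OF ex] in \<open>auto dest: not_less_Least\<close>)
    qed
    have "\<exists>n. B N k n u" for k
    proof (induction k)
      case 0
      obtain n where "n \<ge> N" "u n \<in> G" "\<forall>j\<in>{N..<n}. u j \<notin> G" using next_visit by blast
      then have "B N 0 n u" by (auto simp: B_def)
      then show ?case ..
    next
      case (Suc k)
      then obtain n where n: "B N k n u" ..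
      obtain n' where n': "n' \<ge> Suc n" "u n' \<in> G" "\<forall>j\<in>{Suc n..<n'}. u j \<notin> G" using next_visit by blast
      have "j \<le> n" if "j < n'" "u j \<in> G" for j using n'(3) that by (auto simp: not_less_eq_eq[symmetric])
      then have "{j\<in>{N..<n'}. u j \<in> G} = insert n {j\<in>{N..<n}. u j \<in> G}"
        using n n'(1) by (fastforce simp: B_def)
      then have "B N (Suc k) n' u"
        using n n' N by (auto simp: B_def)
      then show ?case ..
    qed
    with no show False by blast
  qed
qed simp

text \<open>A transition of probability zero is made at a given time with probability zero, and
  there are only countably many times and pairs of states.\<close>

lemma AE_steps_positive: "AE u in L. \<forall>k. 0 < pmf (Q (u k)) (u (Suc k))"
proof -
  have "AE u in L. u k = x \<and> u (Suc k) = x' \<longrightarrow> 0 < pmf (Q x) x'" for k x x'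
  proof (cases "pmf (Q x) x' = 0")
    case True
    then have "prob {u. u k = x \<and> u (Suc k) = x'} = 0"
      using markov_step[of k "\<lambda>_. True" x x'] by (simp add: prefix_determined_def)
    then have "AE u in L. u \<notin> {u. u k = x \<and> u (Suc k) = x'}"
      by (subst (asm) prob_eq_0) (auto intro!: pred_sets)
    then show ?thesis by eventually_elim blast
  qed (simp add: less_le)
  then have "AE u in L. \<forall>k x x'. u k = x \<and> u (Suc k) = x' \<longrightarrow> 0 < pmf (Q x) x'"
    unfolding AE_all_countable by blast
  then show ?thesis by eventually_elim simp
qed

end

section \<open>The chain of successors of visits\<close>

definition after_visit :: "'w set \<Rightarrow> (nat \<Rightarrow> 'w) \<Rightarrow> nat \<Rightarrow> 'w" where
  "after_visit D u j = u (Suc (LEAST k. u k \<in> D) + j)"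

text \<open>Visits are counted from 0 here and from 1 in the successors array.\<close>

primrec visit_successor :: "'w set \<Rightarrow> nat \<Rightarrow> (nat \<Rightarrow> 'w) \<Rightarrow> 'w option" where
  "visit_successor D 0 u = (if \<exists>k. u k \<in> D then Some (after_visit D u 0) else None)"
| "visit_successor D (Suc n) u =
    (if \<exists>k. u k \<in> D then visit_successor D n (after_visit D u) else None)"

lemma visit_successor_None: "\<nexists>k. u k \<in> D \<Longrightarrow> visit_successor D n u = None"
  by (cases n) auto

lemma visit_successor_Suc:
  "visit_successor D 0 u \<noteq> None \<Longrightarrow> visit_successor D (Suc n) u = visit_successor D n (after_visit D u)"
  by (auto split: if_splits)

section \<open>Agreement of the recursion with the enumeration of visits\<close>

text \<open>Translation commutes with removing the least element. The index has to be in range: past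
  the cardinality, \<open>enumerate\<close> takes the \<open>LEAST\<close> of the empty set, which
  does not shift.\<close>

lemma enumerate_shift:
  fixes S :: "nat set"
  assumes "infinite S \<or> n < card S"
  shows "enumerate ((+) c ` S) n = c + enumerate S n"
  using assms
proof (induction n arbitrary: S)
  case 0
  then have "S \<noteq> {}" by auto
  then have "(LEAST s. s \<in> S) \<in> S" by (auto intro: LeastI)
  then show ?case unfolding enumerate_0 by (intro Least_equality) (auto intro: Least_le)
next
  case (Suc n)
  then have "S \<noteq> {}" by auto
  then have l: "(LEAST s. s \<in> S) \<in> S" by (auto intro: LeastI)
  then have "(LEAST s. s \<in> (+) c ` S) = c + (LEAST s. s \<in> S)"
    by (intro Least_equality) (auto intro: Least_le)
  then have "(+) c ` S - {LEAST s. s \<in> (+) c ` S} = (+) c ` (S - {LEAST s. s \<in> S})" by auto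
  moreover have "infinite (S - {LEAST s. s \<in> S}) \<or> n < card (S - {LEAST s. s \<in> S})"
    using Suc.prems l by (cases "finite S") auto
  ultimately show ?case using Suc.IH by (simp only: enumerate_Suc)
qed

text \<open>The recursive form suits the strong Markov property, the closed form matches
  \<open>successor\<close>. After the first visit at time \<open>?l\<close>, the visits of the
  remaining path are the other visits translated back by \<open>Suc ?l\<close>.\<close>

lemma visit_successor_eq_enumerate:
  "visit_successor D n u =
    (if finite {k. u k \<in> D} \<and> card {k. u k \<in> D} \<le> n then None
     else Some (u (Suc (enumerate {k. u k \<in> D} n))))"
proof (induction n arbitrary: u)
  case 0
  then show ?case by (auto simp: after_visit_def enumerate_0 card_gt_0_iff)
next
  case (Suc n)
  show ?case
  proof (cases "\<exists>k. u k \<in> D")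
    case True
    let ?V = "{k. u k \<in> D}" and ?l = "LEAST k. u k \<in> D"
    let ?V' = "{k. after_visit D u k \<in> D}"
    have l: "u ?l \<in> D" using LeastI_ex[OF True] .
    have V: "?V - {?l} = (+) (Suc ?l) ` ?V'"
    proof (intro set_eqI iffI)
      fix k assume k: "k \<in> ?V - {?l}"
      then have "?l \<le> k" by (auto intro: Least_le)
      with k obtain j where "k = Suc ?l + j" using less_imp_Suc_add[of ?l k] by (auto simp: le_less)
      with k show "k \<in> (+) (Suc ?l) ` ?V'" by (auto simp: after_visit_def)
    qed (auto simp: after_visit_def)
    have fin: "finite ?V' \<longleftrightarrow> finite ?V"
      using V finite_image_iff[of "(+) (Suc ?l)" ?V'] by (metis finite_Diff infinite_remove inj_on_add)
    have card: "card ?V = Suc (card ?V')" if "finite ?V"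
    proof -
      have "card ?V' = card (?V - {?l})" unfolding V by (rule card_image[OF inj_on_add, symmetric])
      then show ?thesis using card_Suc_Diff1[OF that, of ?l] l by (simp only: mem_Collect_eq)
    qed
    have "enumerate ?V (Suc n) = Suc ?l + enumerate ?V' n" if "\<not> (finite ?V' \<and> card ?V' \<le> n)"
    proof -
      have "enumerate ?V (Suc n) = enumerate ((+) (Suc ?l) ` ?V') n"
        unfolding enumerate_Suc mem_Collect_eq V ..
      then show ?thesis using that by (simp only: enumerate_shift[of ?V' n] not_le de_Morgan_conj)
    qed
    then show ?thesis
      using True Suc.IH[of "after_visit D u"] fin card
      by (auto simp: after_visit_def[of D u "Suc (enumerate ?V' n)"])
  next
    case False
    then have "{k. u k \<in> D} = {}" by blast
    then show ?thesis using False by simp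
  qed
qed

text \<open>Every time \<open>k\<close> of such a step is the enumeration of some visit index, so
  finitely many indices would leave only finitely many times.\<close>

lemma infinite_visit_successor:
  assumes "infinite {k. u k \<in> D \<and> u (Suc k) = w}"
  shows "infinite {n. visit_successor D n u = Some w}"
proof
  assume fin: "finite {n. visit_successor D n u = Some w}"
  have inf: "infinite {k. u k \<in> D}"
    using assms by (rule contrapos_nn) (auto elim: finite_subset[rotated])
  have "{k. u k \<in> D \<and> u (Suc k) = w} \<subseteq> enumerate {k. u k \<in> D} ` {n. visit_successor D n u = Some w}"
  proof
    fix k assume k: "k \<in> {k. u k \<in> D \<and> u (Suc k) = w}"
    then obtain n where "k = enumerate {k. u k \<in> D} n"
      using range_enumerate[OF inf] by blast
    with k inf show "k \<in> enumerate {k. u k \<in> D} ` {n. visit_successor D n u = Some w}"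
      by (auto simp: visit_successor_eq_enumerate)
  qed
  with fin assms show False by (meson finite_imageI finite_subset)
qed

lemma after_visit_measurable [measurable]:
  "after_visit D \<in> path_space \<rightarrow>\<^sub>M (path_space :: (nat \<Rightarrow> 'w::countable) measure)"
proof (rule measurable_into_path_space)
  fix n
  show "(\<lambda>u :: nat \<Rightarrow> 'w. after_visit D u n) \<in> path_space \<rightarrow>\<^sub>M count_space UNIV"
    unfolding after_visit_def by (rule measurable_compose_countable) measurable
qed

lemma visit_successor_measurable [measurable]:
  "visit_successor D n \<in> path_space \<rightarrow>\<^sub>M count_space (UNIV :: 'w::countable option set)"
proof (induction n)
  case 0
  have "(\<lambda>u :: nat \<Rightarrow> 'w. Some (after_visit D u 0)) \<in> path_space \<rightarrow>\<^sub>M count_space UNIV"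
    by (rule measurable_compose[where g = Some, OF measurable_compose[OF after_visit_measurable path_space_component]]) simp
  then show ?case unfolding visit_successor.simps[abs_def] by measurable
next
  case (Suc n)
  have "(\<lambda>u. visit_successor D n (after_visit D u)) \<in> path_space \<rightarrow>\<^sub>M count_space (UNIV :: 'w option set)"
    by (rule measurable_compose[OF after_visit_measurable Suc])
  then show ?case unfolding visit_successor.simps[abs_def] by measurable
qed

section \<open>The strong Markov property at the first visit\<close>

context markov_path_law
begin

text \<open>The conditional law in the strong Markov property. Conditioning on the successor, and
  not merely on a visit taking place, fixes the starting state of the remaining path.\<close>

definition law_after :: "'w set \<Rightarrow> 'w \<Rightarrow> (nat \<Rightarrow> 'w) measure" where
  "law_after D w = distr (uniform_measure L {u. visit_successor D 0 u = Some w}) path_space (after_visit D)"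

context
  fixes D :: "'w set" and w :: 'w
  assumes pos: "0 < prob {u. visit_successor D 0 u = Some w}"
begin

lemma prob_space_law_after: "prob_space (law_after D w)"
proof -
  have "prob_space (uniform_measure L {u. visit_successor D 0 u = Some w})"
    using pos by (intro prob_space_uniform_measure) (auto simp: emeasure_eq_measure)
  then show ?thesis
    unfolding law_after_def by (rule prob_space.prob_space_distr) simp
qed

lemma measure_law_after:
  assumes [measurable]: "Measurable.pred path_space P"
  shows "prob {u. visit_successor D 0 u = Some w \<and> P (after_visit D u)} =
    prob {u. visit_successor D 0 u = Some w} * measure (law_after D w) {u. P u}"
proof -
  have A: "{u. visit_successor D 0 u = Some w} \<in> sets L" by (simp add: pred_sets)
  have "measure (law_after D w) {u. P u} =
      measure (uniform_measure L {u. visit_successor D 0 u = Some w}) {u. P (after_visit D u)}"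
    unfolding law_after_def by (subst measure_distr) (simp_all add: pred_sets vimage_def)
  also have "\<dots> = prob ({u. visit_successor D 0 u = Some w} \<inter> {u. P (after_visit D u)}) /
      prob {u. visit_successor D 0 u = Some w}"
    using A pos by (intro measure_uniform_measure) (auto simp: emeasure_eq_measure pred_sets)
  also have "{u. visit_successor D 0 u = Some w} \<inter> {u. P (after_visit D u)} =
      {u. visit_successor D 0 u = Some w \<and> P (after_visit D u)}" by blast
  finally show ?thesis using pos by simp
qed

text \<open>The strong Markov property. The event is split by the time \<open>m\<close> of the first
  visit; on each piece the past is determined by a finite prefix, and \<open>markov_word\<close>
  gives the same factor, which comes out of the sum over \<open>m\<close>.\<close>

lemma law_after_cylinder:
  "measure (law_after D w) {u. \<forall>k\<le>n. u k = v k} =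
    (if v 0 = w then \<Prod>k<n. pmf (Q (v k)) (v (Suc k)) else 0)"
proof (cases "v 0 = w")
  case True
  let ?p = "\<Prod>k<n. pmf (Q (v k)) (v (Suc k))"
  let ?f = "\<lambda>u. LEAST k. u k \<in> D"
  let ?A = "\<lambda>u. visit_successor D 0 u = Some w"
  let ?E = "\<lambda>u. ?A u \<and> (\<forall>k\<le>n. after_visit D u k = v k)"
  have fib: "prob {u. ?E u \<and> ?f u = m} = ?p * prob {u. ?A u \<and> ?f u = m}" for m
  proof -
    let ?H = "\<lambda>u. u m \<in> D \<and> (\<forall>k<m. u k \<notin> D)"
    have H: "(\<exists>k. u k \<in> D) \<and> ?f u = m \<longleftrightarrow> ?H u" for u :: "nat \<Rightarrow> 'w"
    proof
      assume "(\<exists>k. u k \<in> D) \<and> ?f u = m"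
      then show "?H u" using LeastI_ex[of "\<lambda>k. u k \<in> D"] not_less_Least[of _ "\<lambda>k. u k \<in> D"] by blast
    next
      assume "?H u"
      then show "(\<exists>k. u k \<in> D) \<and> ?f u = m"
        by (intro conjI Least_equality) (auto simp: not_less[symmetric])
    qed
    have A: "?A u \<and> ?f u = m \<longleftrightarrow> ?H u \<and> u (Suc m) = v 0" for u
    proof -
      have "?A u \<longleftrightarrow> (\<exists>k. u k \<in> D) \<and> u (Suc (?f u)) = v 0"
        unfolding visit_successor.simps after_visit_def True by simp
      then show ?thesis using H[of u] by metis
    qed
    have E: "?E u \<and> ?f u = m \<longleftrightarrow> ?H u \<and> (\<forall>k\<le>n. u (Suc m + k) = v k)" for u
    proof -
      have "?E u \<and> ?f u = m \<longleftrightarrow> (?A u \<and> ?f u = m) \<and> (\<forall>k\<le>n. u (Suc m + k) = v k)"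
        by (auto simp only: after_visit_def)
      also have "\<dots> \<longleftrightarrow> ?H u \<and> u (Suc m + 0) = v 0 \<and> (\<forall>k\<le>n. u (Suc m + k) = v k)"
        unfolding A add_0_right by (simp only: conj_assoc)
      also have "\<dots> \<longleftrightarrow> ?H u \<and> (\<forall>k\<le>n. u (Suc m + k) = v k)"
        using le0[of n] by blast
      finally show ?thesis .
    qed
    \<comment> \<open>The first visit is already decided at time \<open>m\<close>; the index is
      \<open>Suc m\<close> because the word starts one step later.\<close>
    have "prefix_determined (Suc m) ?H" by (auto simp: prefix_determined_def)
    from markov_word[OF this, of n v] show ?thesis unfolding A E by (simp only: mult.commute)
  qed
  have "prob {u \<in> space L. ?E u} = ?p * prob {u \<in> space L. ?A u}"
  proof (rule measure_fibrewise_eq[OF finite_measure_axioms finite_measure_axioms])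
    show "prob {u \<in> space L. ?E u \<and> ?f u = m} = ?p * prob {u \<in> space L. ?A u \<and> ?f u = m}" for m
      using fib[of m] by (simp only: space_L UNIV_I simp_thms)
    show "{u \<in> space L. ?A u} \<in> sets L" "{u \<in> space L. ?E u} \<in> sets L" by measurable
    show "?f \<in> L \<rightarrow>\<^sub>M count_space UNIV" "?f \<in> L \<rightarrow>\<^sub>M count_space UNIV" by measurable
  qed (simp add: prod_nonneg)
  moreover have "prob {u. ?E u} = prob {u. ?A u} * measure (law_after D w) {u. \<forall>k\<le>n. u k = v k}"
    by (rule measure_law_after) measurable
  ultimately show ?thesis using True pos by simp
next
  case False
  have "{u. visit_successor D 0 u = Some w \<and> (\<forall>k\<le>n. after_visit D u k = v k)} = {}"
    using False by (auto split: if_splits)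
  then have "prob {u. visit_successor D 0 u = Some w \<and> (\<forall>k\<le>n. after_visit D u k = v k)} = 0"
    by (simp only: measure_empty)
  then have "prob {u. visit_successor D 0 u = Some w} * measure (law_after D w) {u. \<forall>k\<le>n. u k = v k} = 0"
    using measure_law_after[of "\<lambda>u. \<forall>k\<le>n. u k = v k"] by (simp del: visit_successor.simps)
  then show ?thesis using False pos by simp
qed

lemma markov_law_after: "markov_law Q (law_after D w)"
  unfolding markov_law_def
  using prob_space_law_after law_after_cylinder by (auto simp: law_after_def)

lemma law_after_start: "measure (law_after D w) {u. u 0 = x} = (if x = w then 1 else 0)"
  using law_after_cylinder[of 0 "\<lambda>_. x"] by simp

end

end

text \<open>A law with transition kernel \<open>Q\<close> started at \<open>w\<close> is unique; if none exists, the choice below is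
  arbitrary, but then the chain never reaches \<open>w\<close> with positive probability.\<close>

definition visit_kernel :: "('w::countable \<Rightarrow> 'w pmf) \<Rightarrow> 'w set \<Rightarrow> 'w option \<Rightarrow> 'w option pmf" where
  "visit_kernel Q D a = (case a of None \<Rightarrow> return_pmf None
     | Some w \<Rightarrow> (SOME p. \<forall>L. markov_law Q L \<and> (\<forall>x. measure L {u. u 0 = x} = (if x = w then 1 else 0)) \<longrightarrow>
         (\<forall>c. pmf p c = measure L {u. visit_successor D 0 u = c})))"

text \<open>By \<open>markov_law_unique\<close> at most one law starts at \<open>w\<close>, so the
  distribution of its first successor satisfies the condition under the choice operator. The masses
  add up to one because their events partition the path space.\<close>

lemma pmf_visit_kernel:
  assumes L: "markov_law Q L" and w: "\<And>x. measure L {u. u 0 = x} = (if x = w then 1 else 0)"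
  shows "pmf (visit_kernel Q D (Some w)) c = measure L {u. visit_successor D 0 u = c}"
proof -
  interpret markov_path_law Q L by standard fact
  let ?g = "\<lambda>c. prob {u. visit_successor D 0 u = c}"
  have "emeasure L (\<Union>c. {u. visit_successor D 0 u = c}) =
      (\<integral>\<^sup>+c. emeasure L {u. visit_successor D 0 u = c} \<partial>count_space UNIV)"
    by (rule emeasure_UN_countable) (auto simp: disjoint_family_on_def pred_sets simp del: visit_successor.simps)
  moreover have "(\<Union>c. {u. visit_successor D 0 u = c}) = space L" by auto
  ultimately have "(\<integral>\<^sup>+c. ennreal (?g c) \<partial>count_space UNIV) = 1"
    by (simp only: emeasure_eq_measure prob_space ennreal_1)
  then have "pmf (embed_pmf ?g) c = ?g c" for c by (intro pmf_embed_pmf) auto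
  moreover have "L' = L" if "markov_law Q L'" "\<forall>x. measure L' {u. u 0 = x} = (if x = w then 1 else 0)" for L'
    using that L w by (intro markov_law_unique) auto
  ultimately have "\<exists>p. \<forall>L'. markov_law Q L' \<and> (\<forall>x. measure L' {u. u 0 = x} = (if x = w then 1 else 0)) \<longrightarrow>
      (\<forall>c. pmf p c = measure L' {u. visit_successor D 0 u = c})"
    by (intro exI[of _ "embed_pmf ?g"]) blast
  from someI_ex[OF this] show ?thesis
    unfolding visit_kernel_def using L w by simp
qed

section \<open>The Markov property of the chain of successors\<close>

text \<open>Induction that discards the first visit: given the successor \<open>w\<close>, the
  remaining path again follows a law with kernel \<open>Q\<close>, to which the induction hypothesis
  applies. This is why \<open>L\<close> varies in the induction.\<close>

lemma visit_successor_markov: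
  assumes "markov_law Q L"
  shows "measure L {u. \<forall>k\<le>Suc n. visit_successor D k u = a k} =
    measure L {u. \<forall>k\<le>n. visit_successor D k u = a k} * pmf (visit_kernel Q D (a n)) (a (Suc n))"
  using assms
proof (induction n arbitrary: L a)
  case (0 L a)
  interpret markov_path_law Q L by standard fact
  have eq: "{u. \<forall>k\<le>Suc 0. visit_successor D k u = a k} =
      {u. visit_successor D 0 u = a 0 \<and> visit_successor D (Suc 0) u = a (Suc 0)}"
    "{u. \<forall>k\<le>0. visit_successor D k u = a k} = {u. visit_successor D 0 u = a 0}"
    by (auto simp: le_Suc_eq simp del: visit_successor.simps)
  show ?case
  proof (cases "a 0")
    case None
    \<comment> \<open>Without any visit all entries are \<open>None\<close>: the extra state is
      absorbing, in accordance with \<open>visit_kernel\<close>.\<close>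
    have "{u. visit_successor D 0 u = None \<and> visit_successor D (Suc 0) u = a (Suc 0)} =
        (if a (Suc 0) = None then {u. visit_successor D 0 u = None} else {})"
      by (auto split: if_splits)
    then show ?thesis unfolding eq None
      by (auto simp: visit_kernel_def indicator_def simp del: visit_successor.simps)
  next
    case (Some w)
    have eq': "{u. visit_successor D 0 u = Some w \<and> visit_successor D (Suc 0) u = a (Suc 0)} =
        {u. visit_successor D 0 u = Some w \<and> visit_successor D 0 (after_visit D u) = a (Suc 0)}"
      using visit_successor_Suc[of D _ 0] by (auto simp del: visit_successor.simps)
    show ?thesis
    proof (cases "prob {u. visit_successor D 0 u = Some w} = 0")
      case True
      \<comment> \<open>If \<open>w\<close> is almost surely not the first successor, both sides
        vanish, whatever value the kernel has there.\<close>
      have "prob {u. visit_successor D 0 u = Some w \<and> visit_successor D (Suc 0) u = a (Suc 0)} \<le>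
          prob {u. visit_successor D 0 u = Some w}"
        by (rule finite_measure_mono) (auto simp: pred_sets simp del: visit_successor.simps)
      then show ?thesis unfolding eq Some using True by (simp add: measure_le_0_iff del: visit_successor.simps)
    next
      case False
      then have pos: "0 < prob {u. visit_successor D 0 u = Some w}" using measure_nonneg less_le by metis
      show ?thesis
        unfolding eq Some eq'
        by (subst measure_law_after[OF pos])
          (simp_all add: pmf_visit_kernel[OF markov_law_after[OF pos] law_after_start[OF pos]]
            del: visit_successor.simps)
    qed
  qed
next
  case (Suc n L a)
  interpret markov_path_law Q L by standard fact
  have split: "{u. \<forall>k\<le>Suc m. visit_successor D k u = a k} =
      {u. visit_successor D 0 u = a 0 \<and> (\<forall>k\<le>m. visit_successor D (Suc k) u = a (Suc k))}" for m
  proof -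
    have "(\<forall>k\<le>Suc m. visit_successor D k u = a k) \<longleftrightarrow>
        visit_successor D 0 u = a 0 \<and> (\<forall>k\<le>m. visit_successor D (Suc k) u = a (Suc k))" for u
      unfolding less_Suc_eq_le[symmetric] by (rule All_less_Suc2)
    then show ?thesis by (simp only:)
  qed
  show ?case
  proof (cases "a 0")
    case None
    have none: "{u. visit_successor D 0 u = None \<and> (\<forall>k\<le>m. visit_successor D (Suc k) u = a (Suc k))} =
        (if \<forall>k\<le>m. a (Suc k) = None then {u. visit_successor D 0 u = None} else {})" for m
      by (auto split: if_splits)
    show ?thesis unfolding split None none
      by (auto simp add: le_Suc_eq visit_kernel_def indicator_def simp del: visit_successor.simps)
  next
    case (Some w)
    have shift: "{u. visit_successor D 0 u = Some w \<and> (\<forall>k\<le>m. visit_successor D (Suc k) u = a (Suc k))} =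
        {u. visit_successor D 0 u = Some w \<and> (\<forall>k\<le>m. visit_successor D k (after_visit D u) = a (Suc k))}" for m
      using visit_successor_Suc[of D] by (auto simp del: visit_successor.simps)
    show ?thesis
    proof (cases "prob {u. visit_successor D 0 u = Some w} = 0")
      case True
      have "prob {u. visit_successor D 0 u = Some w \<and> (\<forall>k\<le>m. visit_successor D (Suc k) u = a (Suc k))} \<le>
          prob {u. visit_successor D 0 u = Some w}" for m
        by (rule finite_measure_mono) (auto simp: pred_sets simp del: visit_successor.simps)
      then show ?thesis unfolding split Some using True by (simp add: measure_le_0_iff del: visit_successor.simps)
    next
      case False
      then have pos: "0 < prob {u. visit_successor D 0 u = Some w}" using measure_nonneg less_le by metis
      have shift_prob: "prob {u. visit_successor D 0 u = Some w \<and> (\<forall>k\<le>m. visit_successor D k (after_visit D u) = a (Suc k))} =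
          prob {u. visit_successor D 0 u = Some w} *
          measure (law_after D w) {u. \<forall>k\<le>m. visit_successor D k u = a (Suc k)}" for m
        by (rule measure_law_after[OF pos]) measurable
      show ?thesis
        unfolding split Some shift shift_prob Suc.IH[OF markov_law_after[OF pos], of "\<lambda>k. a (Suc k)"] by simp
    qed
  qed
qed

section \<open>Recurrence of the chain of successors\<close>

lemma infinite_Suc_iff: "infinite {n. P (Suc n)} \<longleftrightarrow> infinite {n. P n}"
proof -
  have "{n. P n} \<subseteq> insert 0 (Suc ` {n. P (Suc n)})"
  proof
    fix n assume "n \<in> {n. P n}"
    then show "n \<in> insert 0 (Suc ` {n. P (Suc n)})" by (cases n) auto
  qed
  moreover have "Suc ` {n. P (Suc n)} \<subseteq> {n. P n}" by auto
  ultimately show ?thesis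
    by (meson finite_imageD finite_imageI finite_insert finite_subset inj_Suc inj_on_subset subset_UNIV)
qed

text \<open>Transitions depend on the state only through \<open>g\<close>, and only \<open>g\<close>
  of the initial state is assumed to recur: in the application the initial pair carries
  \<open>None\<close> and never returns.\<close>

lemma (in markov_path_law) AE_visit_successor_recurrent:
  fixes g :: "'w \<Rightarrow> 'x"
  assumes g: "\<And>w w'. g w = g w' \<Longrightarrow> Q w = Q w'"
    and rec: "AE u in L. infinite {n. g (u n) = g (u 0)}"
    and start: "AE u in L. u 0 \<notin> D"
  shows "AE u in L. \<forall>w. visit_successor D 0 u = Some w \<longrightarrow> infinite {n. visit_successor D n u = Some w}"
proof -
  have 1: "AE u in L. \<forall>a b. 0 < pmf (Q a) b \<longrightarrow> infinite {n. u n = a} \<longrightarrow>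
      infinite {n. u n = a \<and> u (Suc n) = b}"
    unfolding AE_all_countable
  proof (intro allI)
    fix a b
    show "AE u in L. 0 < pmf (Q a) b \<longrightarrow> infinite {n. u n = a} \<longrightarrow> infinite {n. u n = a \<and> u (Suc n) = b}"
      using AE_step_infinitely_often[of "pmf (Q a) b" "{a}" b] by (cases "0 < pmf (Q a) b") simp_all
  qed
  have 2: "AE u in L. \<forall>a b. 0 < pmf (Q a) b \<longrightarrow> infinite {n. g (u n) = g a} \<longrightarrow>
      infinite {n. g (u n) = g a \<and> u (Suc n) = b}"
    unfolding AE_all_countable
  proof (intro allI)
    fix a b
    have "pmf (Q a) b \<le> pmf (Q x) b" if "x \<in> {x. g x = g a}" for x
      using that g[of x a] by simp
    then show "AE u in L. 0 < pmf (Q a) b \<longrightarrow> infinite {n. g (u n) = g a} \<longrightarrow>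
        infinite {n. g (u n) = g a \<and> u (Suc n) = b}"
      using AE_step_infinitely_often[of "pmf (Q a) b" "{x. g x = g a}" b] by (cases "0 < pmf (Q a) b") simp_all
  qed
  show ?thesis
    using AE_steps_positive rec start 1 2
  proof eventually_elim
    fix u
    assume pos: "\<forall>k. 0 < pmf (Q (u k)) (u (Suc k))" and rec: "infinite {n. g (u n) = g (u 0)}"
      and start: "u 0 \<notin> D"
      and step: "\<forall>a b. 0 < pmf (Q a) b \<longrightarrow> infinite {n. u n = a} \<longrightarrow> infinite {n. u n = a \<and> u (Suc n) = b}"
      and step0: "\<forall>a b. 0 < pmf (Q a) b \<longrightarrow> infinite {n. g (u n) = g a} \<longrightarrow>
          infinite {n. g (u n) = g a \<and> u (Suc n) = b}"
    \<comment> \<open>Each step made recurs infinitely often, hence so does its target, from which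
      the next step is made. The first step uses the whole fibre of \<open>g\<close>, the later ones
      single states.\<close>
    have inf: "infinite {n. u n = u (Suc k)}" for k
    proof (induction k)
      case 0
      have "infinite {n. g (u n) = g (u 0) \<and> u (Suc n) = u (Suc 0)}" using step0 pos rec by blast
      then have "infinite {n. u (Suc n) = u (Suc 0)}" by (rule contrapos_nn) (auto elim: finite_subset[rotated])
      then show ?case by (rule infinite_Suc_iff[THEN iffD1])
    next
      case (Suc k)
      then have "infinite {n. u n = u (Suc k) \<and> u (Suc n) = u (Suc (Suc k))}" using step pos by blast
      then have "infinite {n. u (Suc n) = u (Suc (Suc k))}" by (rule contrapos_nn) (auto elim: finite_subset[rotated])
      then show ?case by (rule infinite_Suc_iff[THEN iffD1])
    qed
    show "\<forall>w. visit_successor D 0 u = Some w \<longrightarrow> infinite {n. visit_successor D n u = Some w}"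
    proof (intro allI impI)
      fix w assume w: "visit_successor D 0 u = Some w"
      define m where "m = (LEAST k. u k \<in> D)"
      have ex: "\<exists>k. u k \<in> D" and um: "u (Suc m) = w"
        using w by (auto simp: after_visit_def m_def split: if_splits)
      have m: "u m \<in> D" unfolding m_def by (rule LeastI_ex[OF ex])
      \<comment> \<open>\<open>u 0\<close> itself need not recur, but the first visit to
        \<open>D\<close> happens at a positive time and is therefore covered by
        \<open>inf\<close>.\<close>
      then obtain k where k: "m = Suc k" using start by (cases m) auto
      have "infinite {n. u n = u m \<and> u (Suc n) = w}" using step pos inf[of k] um k by blast
      then have "infinite {n. u n \<in> D \<and> u (Suc n) = w}"
        by (rule contrapos_nn) (use m in \<open>auto elim: finite_subset[rotated]\<close>)
      then show "infinite {n. visit_successor D n u = Some w}" by (rule infinite_visit_successor)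
    qed
  qed
qed

section \<open>Hidden Markov models\<close>

text \<open>The read-out distributions are point masses: given the hidden path, both sides of the
  product formula are zero or one.\<close>

lemma hidden_markov_pair_function:
  fixes X :: "nat \<Rightarrow> 'a \<Rightarrow> 'x::countable" and g :: "'x \<Rightarrow> 'r::countable"
  assumes chain: "homogeneous_markov_chain N n0 X"
  shows "hidden_markov_pair N n0 X (\<lambda>n \<omega>. g (X n \<omega>))"
proof -
  interpret prob_space N using chain by (simp add: homogeneous_markov_chain_def discrete_process_def)
  have X: "X n \<in> N \<rightarrow>\<^sub>M count_space UNIV" if "n0 \<le> n" for n
    using chain that by (simp add: homogeneous_markov_chain_def discrete_process_def)
  have proc: "discrete_process N n0 (\<lambda>n \<omega>. g (X n \<omega>))"
    using prob_space_axioms measurable_compose[OF X, of _ g] by (simp add: discrete_process_def)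
  have single: "\<P>(\<omega> in N. g (X n \<omega>) \<in> B \<bar> X n \<omega> = x) = (if g x \<in> B then 1 else 0)"
    if "\<P>(\<omega> in N. X n \<omega> = x) > 0" for n x B
  proof -
    have "{\<omega> \<in> space N. g (X n \<omega>) \<in> B \<and> X n \<omega> = x} = (if g x \<in> B then {\<omega> \<in> space N. X n \<omega> = x} else {})"
      by auto
    then show ?thesis using that by (simp add: cond_prob_def)
  qed
  have "\<P>(\<omega> in N. \<forall>n\<in>{n0..m}. g (X n \<omega>) \<in> A n \<bar> \<forall>n\<in>{n0..m}. X n \<omega> = x n) =
      (\<Prod>n=n0..m. \<P>(\<omega> in N. g (X n \<omega>) \<in> A n \<bar> X n \<omega> = x n))"
    if pos: "\<P>(\<omega> in N. \<forall>n\<in>{n0..m}. X n \<omega> = x n) > 0" for m A x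
  proof -
    have "{\<omega> \<in> space N. (\<forall>n\<in>{n0..m}. g (X n \<omega>) \<in> A n) \<and> (\<forall>n\<in>{n0..m}. X n \<omega> = x n)} =
        (if \<forall>n\<in>{n0..m}. g (x n) \<in> A n then {\<omega> \<in> space N. \<forall>n\<in>{n0..m}. X n \<omega> = x n} else {})"
    proof -
      have "(\<forall>n\<in>{n0..m}. g (X n \<omega>) \<in> A n) \<and> (\<forall>n\<in>{n0..m}. X n \<omega> = x n) \<longleftrightarrow>
          (\<forall>n\<in>{n0..m}. g (x n) \<in> A n) \<and> (\<forall>n\<in>{n0..m}. X n \<omega> = x n)" for \<omega>
        by metis
      then show ?thesis by (simp only:) simp
    qed
    then have lhs: "\<P>(\<omega> in N. \<forall>n\<in>{n0..m}. g (X n \<omega>) \<in> A n \<bar> \<forall>n\<in>{n0..m}. X n \<omega> = x n) =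
        (if \<forall>n\<in>{n0..m}. g (x n) \<in> A n then 1 else 0)"
      using pos by (simp add: cond_prob_def)
    have "\<P>(\<omega> in N. X n \<omega> = x n) > 0" if n: "n \<in> {n0..m}" for n
    proof -
      have [measurable]: "X n \<in> N \<rightarrow>\<^sub>M count_space UNIV" using X n by simp
      have "\<P>(\<omega> in N. \<forall>n\<in>{n0..m}. X n \<omega> = x n) \<le> \<P>(\<omega> in N. X n \<omega> = x n)"
        using n by (intro finite_measure_mono) auto
      then show ?thesis using pos by simp
    qed
    then have "(\<Prod>n=n0..m. \<P>(\<omega> in N. g (X n \<omega>) \<in> A n \<bar> X n \<omega> = x n)) =
        (\<Prod>n=n0..m. if g (x n) \<in> A n then 1 else 0)"
      by (intro prod.cong single) auto
    also have "\<dots> = (if \<forall>n\<in>{n0..m}. g (x n) \<in> A n then 1 else 0)"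
      by (auto intro!: prod.neutral)
    finally show ?thesis unfolding lhs by simp
  qed
  moreover have "\<exists>f :: 'x \<Rightarrow> 'r pmf. \<forall>n\<ge>n0. \<forall>x B. \<P>(\<omega> in N. X n \<omega> = x) > 0 \<longrightarrow>
        \<P>(\<omega> in N. g (X n \<omega>) \<in> B \<bar> X n \<omega> = x) = measure_pmf.prob (f x) B"
    by (rule exI[of _ "\<lambda>x. return_pmf (g x)"]) (auto simp: single indicator_def)
  ultimately show ?thesis
    unfolding hidden_markov_pair_def using chain proc by blast
qed

text \<open>The hidden state is paired with the \<^emph>\<open>previous\<close> read-out, so that the transition
  probabilities of the pair depend on the hidden state alone.\<close>

definition pair_path :: "(nat \<Rightarrow> 'a \<Rightarrow> 'x) \<Rightarrow> (nat \<Rightarrow> 'a \<Rightarrow> 'r) \<Rightarrow> 'a \<Rightarrow> nat \<Rightarrow> 'r option \<times> 'x" where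
  "pair_path X Z \<omega> n = (case n of 0 \<Rightarrow> None | Suc m \<Rightarrow> Some (Z m \<omega>), X n \<omega>)"

text \<open>The read-out drawn from \<open>f\<close> belongs to the current hidden state and is
  stored with the next one, independently of the move by \<open>K\<close>. It always carries
  \<open>Some\<close>, since \<open>None\<close> marks time zero only.\<close>

definition pair_kernel :: "('x \<Rightarrow> 'x pmf) \<Rightarrow> ('x \<Rightarrow> 'r pmf) \<Rightarrow> 'r option \<times> 'x \<Rightarrow> ('r option \<times> 'x) pmf" where
  "pair_kernel K f w = map_pmf (map_prod Some id) (pair_pmf (f (snd w)) (K (snd w)))"

lemma pmf_pair_kernel:
  "pmf (pair_kernel K f w) (c, x) = (case c of None \<Rightarrow> 0 | Some z \<Rightarrow> pmf (f (snd w)) z * pmf (K (snd w)) x)"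
proof (cases c)
  case None
  then show ?thesis by (auto simp: pair_kernel_def pmf_eq_0_set_pmf)
next
  case (Some z)
  have "pmf (pair_kernel K f w) (map_prod Some id (z, x)) = pmf (pair_pmf (f (snd w)) (K (snd w))) (z, x)"
    unfolding pair_kernel_def by (rule pmf_map_inj') (auto intro!: prod.inj_map)
  then show ?thesis using Some by (simp add: pmf_pair)
qed

text \<open>Storing the previous read-out delays every visit by one step, and the successor pair
  stores the value right after the visit. \<open>Option.bind\<close> turns an absent visit into
  \<open>None\<close>; the \<open>None\<close> stored at time zero is never part of a
  successor.\<close>

lemma visit_successor_pair_path:
  "Option.bind (visit_successor {w. fst w = Some y} n (pair_path X Z \<omega>)) fst =
    visit_successor {y} n (\<lambda>k. Z k \<omega>)"
proof -
  let ?V = "{k. Z k \<omega> = y}"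
  have V: "{k. fst (pair_path X Z \<omega> k) = Some y} = (+) 1 ` ?V"
  proof (intro set_eqI)
    fix k show "k \<in> {k. fst (pair_path X Z \<omega> k) = Some y} \<longleftrightarrow> k \<in> (+) 1 ` ?V"
      by (cases k) (auto simp: pair_path_def)
  qed
  have "finite ((+) 1 ` ?V) \<longleftrightarrow> finite ?V" "card ((+) 1 ` ?V) = card ?V"
    by (rule finite_image_iff[OF inj_on_add], rule card_image[OF inj_on_add])
  moreover have "enumerate ((+) 1 ` ?V) n = 1 + enumerate ?V n" if "\<not> (finite ?V \<and> card ?V \<le> n)"
    using that by (intro enumerate_shift) auto
  ultimately show ?thesis
    unfolding visit_successor_eq_enumerate mem_Collect_eq V singleton_iff
    by (auto simp: pair_path_def)
qed

lemma successor_eq_visit_successor: "successor u y (Suc n) = visit_successor {y} n u"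
  by (simp add: successor_def visit_successor_eq_enumerate Let_def less_Suc_eq_le)

section \<open>The law of the pair chain\<close>

text \<open>Both conditions on the pair combine to a product formula for the joint law of hidden
  states and earlier read-outs; the factors added at each new time are the entries of
  \<open>pair_kernel\<close>.\<close>

lemma hidden_markov_pair_law:
  fixes X :: "nat \<Rightarrow> 'a \<Rightarrow> 'x::countable" and Z :: "nat \<Rightarrow> 'a \<Rightarrow> 'r::countable"
  assumes pair: "hidden_markov_pair N 0 X Z"
  obtains K f where "markov_law (pair_kernel K f) (distr N path_space (pair_path X Z))"
    and "pair_path X Z \<in> N \<rightarrow>\<^sub>M path_space"
proof -
  have chain: "homogeneous_markov_chain N 0 X" and Z: "discrete_process N 0 Z"
    using pair by (auto simp: hidden_markov_pair_def)
  interpret prob_space N using Z by (simp add: discrete_process_def)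
  have X[measurable]: "X n \<in> N \<rightarrow>\<^sub>M count_space UNIV" for n
    using chain by (simp add: homogeneous_markov_chain_def discrete_process_def)
  have Z[measurable]: "Z n \<in> N \<rightarrow>\<^sub>M count_space UNIV" for n
    using Z by (simp add: discrete_process_def)
  obtain K where K: "\<And>n x x'. \<P>(\<omega> in N. \<forall>k\<in>{0..n}. X k \<omega> = x k) > 0 \<Longrightarrow>
      \<P>(\<omega> in N. X (Suc n) \<omega> = x' \<bar> \<forall>k\<in>{0..n}. X k \<omega> = x k) = pmf (K (x n)) x'"
    using chain unfolding homogeneous_markov_chain_def by blast
  obtain f :: "'x \<Rightarrow> 'r pmf" where "\<forall>n\<ge>0. \<forall>x B. \<P>(\<omega> in N. X n \<omega> = x) > 0 \<longrightarrow>
      \<P>(\<omega> in N. Z n \<omega> \<in> B \<bar> X n \<omega> = x) = measure_pmf.prob (f x) B"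
    using pair unfolding hidden_markov_pair_def by (elim conjE exE)
  then have f: "\<P>(\<omega> in N. Z n \<omega> \<in> B \<bar> X n \<omega> = x) = measure_pmf.prob (f x) B"
    if "\<P>(\<omega> in N. X n \<omega> = x) > 0" for n x B
    using that by blast
  have hid: "\<P>(\<omega> in N. \<forall>n\<in>{0..m}. Z n \<omega> \<in> A n \<bar> \<forall>n\<in>{0..m}. X n \<omega> = x n) =
      (\<Prod>n=0..m. \<P>(\<omega> in N. Z n \<omega> \<in> A n \<bar> X n \<omega> = x n))"
    if "\<P>(\<omega> in N. \<forall>n\<in>{0..m}. X n \<omega> = x n) > 0" for m A x
    using pair that unfolding hidden_markov_pair_def by blast

  define P where "P x n = \<P>(\<omega> in N. \<forall>k\<in>{0..n}. X k \<omega> = x k)" for x :: "nat \<Rightarrow> 'x" and n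
  have P_nonneg: "0 \<le> P x n" for x n by (simp add: P_def)
  have P_Suc: "P x (Suc n) = P x n * pmf (K (x n)) (x (Suc n))" for x n
  proof -
    have eq: "\<P>(\<omega> in N. X (Suc n) \<omega> = x (Suc n) \<and> (\<forall>k\<in>{0..n}. X k \<omega> = x k)) = P x (Suc n)"
      unfolding P_def by (rule arg_cong[where f=prob]) (auto simp: le_Suc_eq)
    show ?thesis
    proof (cases "P x n = 0")
      case True
      have "P x (Suc n) \<le> P x n" unfolding P_def by (rule finite_measure_mono) auto
      then show ?thesis using True P_nonneg[of x "Suc n"] by simp
    next
      case False
      then have "P x n > 0" using P_nonneg[of x n] by simp
      from K[OF this[unfolded P_def], of "x (Suc n)"] show ?thesis
        using False unfolding cond_prob_def eq by (simp add: P_def[symmetric] field_simps)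
    qed
  qed
  have joint: "\<P>(\<omega> in N. (\<forall>k<n. Z k \<omega> = z k) \<and> (\<forall>k\<in>{0..n}. X k \<omega> = x k)) = P x n * (\<Prod>k<n. pmf (f (x k)) (z k))"
    for n x z
  proof (cases "P x n = 0")
    case True
    have "\<P>(\<omega> in N. (\<forall>k<n. Z k \<omega> = z k) \<and> (\<forall>k\<in>{0..n}. X k \<omega> = x k)) \<le> P x n"
      unfolding P_def by (rule finite_measure_mono) auto
    then show ?thesis using True by (simp add: measure_le_0_iff)
  next
    case False
    then have pos: "P x n > 0" using P_nonneg[of x n] by simp
    \<comment> \<open>The read-out at time \<open>n\<close> is left unrestricted, as it is only
      stored at time \<open>n + 1\<close>; its factor in the product is one.\<close>
    let ?A = "\<lambda>k. if k < n then {z k} else UNIV"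
    have single: "\<P>(\<omega> in N. Z k \<omega> \<in> ?A k \<bar> X k \<omega> = x k) = measure_pmf.prob (f (x k)) (?A k)" if "k \<le> n" for k
    proof (rule f)
      have "P x n \<le> \<P>(\<omega> in N. X k \<omega> = x k)"
        unfolding P_def by (rule finite_measure_mono) (use that in auto)
      then show "\<P>(\<omega> in N. X k \<omega> = x k) > 0" using pos by simp
    qed
    have "{\<omega> \<in> space N. (\<forall>k\<in>{0..n}. Z k \<omega> \<in> ?A k) \<and> (\<forall>k\<in>{0..n}. X k \<omega> = x k)} =
        {\<omega> \<in> space N. (\<forall>k<n. Z k \<omega> = z k) \<and> (\<forall>k\<in>{0..n}. X k \<omega> = x k)}"
      by (auto split: if_splits)
    then have "\<P>(\<omega> in N. (\<forall>k<n. Z k \<omega> = z k) \<and> (\<forall>k\<in>{0..n}. X k \<omega> = x k)) / P x n =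
        (\<Prod>k=0..n. \<P>(\<omega> in N. Z k \<omega> \<in> ?A k \<bar> X k \<omega> = x k))"
      using hid[OF pos[unfolded P_def], of ?A] unfolding cond_prob_def P_def by (simp only:)
    also have "\<dots> = (\<Prod>k=0..n. measure_pmf.prob (f (x k)) (?A k))"
      by (rule prod.cong[OF refl]) (rule single, simp)
    also have "\<dots> = (\<Prod>k\<in>insert n {..<n}. measure_pmf.prob (f (x k)) (?A k))"
      by (rule prod.cong) auto
    also have "\<dots> = (\<Prod>k<n. pmf (f (x k)) (z k))"
      by (simp add: measure_pmf_single)
    finally show ?thesis using pos by (simp add: field_simps)
  qed
  have path: "pair_path X Z \<in> N \<rightarrow>\<^sub>M path_space"
  proof (rule measurable_into_path_space)
    fix n
    have "(\<lambda>\<omega>. case n of 0 \<Rightarrow> None | Suc m \<Rightarrow> Some (Z m \<omega>)) \<in> N \<rightarrow>\<^sub>M count_space UNIV"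
      using measurable_compose[OF Z, of Some] by (cases n) simp_all
    then have "(\<lambda>\<omega>. pair_path X Z \<omega> n) \<in> N \<rightarrow>\<^sub>M count_space UNIV \<Otimes>\<^sub>M count_space UNIV"
      unfolding pair_path_def using X by measurable
    then show "(\<lambda>\<omega>. pair_path X Z \<omega> n) \<in> N \<rightarrow>\<^sub>M count_space UNIV"
      by (simp add: pair_measure_countable)
  qed
  let ?L = "distr N path_space (pair_path X Z)"
  \<comment> \<open>The first component is \<open>None\<close> at time zero and only there; any
    other pattern has probability zero.\<close>
  have cyl: "measure ?L {u. \<forall>k\<le>n. u k = v k} =
      (if fst (v 0) = None \<and> (\<forall>k<n. fst (v (Suc k)) \<noteq> None)
       then P (\<lambda>k. snd (v k)) n * (\<Prod>k<n. pmf (f (snd (v k))) (the (fst (v (Suc k))))) else 0)" for n v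
  proof -
    have "measure ?L {u. \<forall>k\<le>n. u k = v k} = \<P>(\<omega> in N. \<forall>k\<le>n. pair_path X Z \<omega> k = v k)"
      by (subst measure_distr[OF path]) (auto intro!: pred_sets arg_cong[where f=prob])
    also have "\<dots> = \<P>(\<omega> in N. (fst (v 0) = None \<and> (\<forall>k<n. fst (v (Suc k)) \<noteq> None)) \<and>
        (\<forall>k<n. Z k \<omega> = the (fst (v (Suc k)))) \<and> (\<forall>k\<in>{0..n}. X k \<omega> = snd (v k)))"
    proof -
      have 1: "(\<forall>k\<le>n. pair_path X Z \<omega> k = v k) \<longleftrightarrow>
          (\<forall>k\<le>n. fst (pair_path X Z \<omega> k) = fst (v k)) \<and> (\<forall>k\<in>{0..n}. X k \<omega> = snd (v k))" for \<omega>
        by (auto simp: prod_eq_iff pair_path_def)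
      have 2: "(\<forall>k\<le>n. fst (pair_path X Z \<omega> k) = fst (v k)) \<longleftrightarrow>
          fst (v 0) = None \<and> (\<forall>k<n. Some (Z k \<omega>) = fst (v (Suc k)))" for \<omega>
        unfolding less_Suc_eq_le[symmetric] All_less_Suc2 by (auto simp: pair_path_def)
      have 3: "Some (Z k \<omega>) = fst (v (Suc k)) \<longleftrightarrow>
          fst (v (Suc k)) \<noteq> None \<and> Z k \<omega> = the (fst (v (Suc k)))" for k \<omega>
        by (cases "fst (v (Suc k))") auto
      have "(\<forall>k\<le>n. pair_path X Z \<omega> k = v k) \<longleftrightarrow>
          (fst (v 0) = None \<and> (\<forall>k<n. fst (v (Suc k)) \<noteq> None)) \<and>
          (\<forall>k<n. Z k \<omega> = the (fst (v (Suc k)))) \<and> (\<forall>k\<in>{0..n}. X k \<omega> = snd (v k))" for \<omega>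
        unfolding 1 2 3 by blast
      then show ?thesis by (simp only:)
    qed
    also have "\<dots> = (if fst (v 0) = None \<and> (\<forall>k<n. fst (v (Suc k)) \<noteq> None)
        then \<P>(\<omega> in N. (\<forall>k<n. Z k \<omega> = the (fst (v (Suc k)))) \<and> (\<forall>k\<in>{0..n}. X k \<omega> = snd (v k))) else 0)"
      (is "\<P>(\<omega> in N. ?C \<and> ?S \<omega>) = _")
      by (cases ?C; simp only: if_True if_False simp_thms; simp)
    finally show ?thesis unfolding joint .
  qed
  have "measure ?L {u. \<forall>k\<le>Suc n. u k = v k} =
      measure ?L {u. \<forall>k\<le>n. u k = v k} * pmf (pair_kernel K f (v n)) (v (Suc n))" for n v
    unfolding cyl using pmf_pair_kernel[of K f "v n" "fst (v (Suc n))" "snd (v (Suc n))"]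
    by (auto simp: P_Suc less_Suc_eq split: option.splits)
  then have "markov_law (pair_kernel K f) ?L"
    using prob_space_distr[OF path] by (auto simp: markov_law_def)
  with path that show ?thesis by blast
qed

section \<open>Almost sure recurrence and laws of whole paths\<close>

text \<open>Recurrence concerns each starting state of positive probability; every other starting
  state is a null event, and countability merges all cases into one almost sure statement.\<close>

lemma recurrent_chain_AE:
  fixes X :: "nat \<Rightarrow> 'a \<Rightarrow> 'x::countable"
  assumes X: "discrete_process N 0 X" and rec: "recurrent_chain N 0 X"
  shows "AE \<omega> in N. infinite {n. X n \<omega> = X 0 \<omega>}"
proof -
  interpret prob_space N using X by (simp add: discrete_process_def)
  have [measurable]: "X n \<in> N \<rightarrow>\<^sub>M count_space UNIV" for n
    using X by (simp add: discrete_process_def)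
  have [measurable]: "Measurable.pred N (\<lambda>\<omega>. infinite {n. X n \<omega> = x})" for x
    unfolding infinite_nat_iff_unbounded_le mem_Collect_eq by measurable
  have "AE \<omega> in N. X 0 \<omega> = x \<longrightarrow> infinite {n. X n \<omega> = x}" for x
  proof (cases "\<P>(\<omega> in N. X 0 \<omega> = x) = 0")
    case True
    then have "AE \<omega> in N. \<omega> \<notin> {\<omega> \<in> space N. X 0 \<omega> = x}"
      by (subst (asm) prob_eq_0) auto
    then show ?thesis by (rule AE_mp) auto
  next
    case False
    then have "\<P>(\<omega> in N. X 0 \<omega> = x) > 0" by (simp add: less_le)
    with rec have "\<P>(\<omega> in N. infinite {n. X n \<omega> = x} \<bar> X 0 \<omega> = x) = 1"
      unfolding recurrent_chain_def by simp
    then have "\<P>(\<omega> in N. infinite {n. X n \<omega> = x} \<and> X 0 \<omega> = x) = \<P>(\<omega> in N. X 0 \<omega> = x)"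
      using False by (simp add: cond_prob_def)
    then have "prob ({\<omega> \<in> space N. X 0 \<omega> = x} - {\<omega> \<in> space N. infinite {n. X n \<omega> = x} \<and> X 0 \<omega> = x}) = 0"
      by (subst finite_measure_Diff) auto
    then have "AE \<omega> in N. \<omega> \<notin> {\<omega> \<in> space N. X 0 \<omega> = x} - {\<omega> \<in> space N. infinite {n. X n \<omega> = x} \<and> X 0 \<omega> = x}"
      by (subst (asm) prob_eq_0) auto
    then show ?thesis by (rule AE_mp) auto
  qed
  then have "AE \<omega> in N. \<forall>x. X 0 \<omega> = x \<longrightarrow> infinite {n. X n \<omega> = x}"
    unfolding AE_all_countable by blast
  then show ?thesis by (rule AE_mp) auto
qed

text \<open>Finite-dimensional boxes determine a finite measure on the product. Equality of path
  laws is what transfers the row, a functional of infinitely many coordinates, from one process to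
  the other.\<close>

lemma path_law_eqI:
  fixes M :: "'a measure" and N :: "'b measure" and Y :: "nat \<Rightarrow> 'a \<Rightarrow> 'r::countable"
  assumes Y: "discrete_process M 0 Y" and Z: "discrete_process N 0 Z"
    and fdd: "same_finite_dim_distributions 0 M Y N Z"
  shows "distr M path_space (\<lambda>\<omega> k. Y k \<omega>) = distr N path_space (\<lambda>\<omega> k. Z k \<omega>)"
proof -
  have path: "(\<lambda>\<omega> k. Y k \<omega>) \<in> M \<rightarrow>\<^sub>M path_space" "(\<lambda>\<omega> k. Z k \<omega>) \<in> N \<rightarrow>\<^sub>M path_space"
    using Y Z by (auto intro!: measurable_into_path_space simp: discrete_process_def)
  have emb: "emeasure (distr K path_space (\<lambda>\<omega> k. U k \<omega>)) (prod_emb UNIV (\<lambda>_. count_space UNIV) J (Pi\<^sub>E J A)) =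
      emeasure (distr K (Pi\<^sub>M J (\<lambda>_. count_space UNIV)) (\<lambda>\<omega>. \<lambda>n\<in>J. U n \<omega>)) (Pi\<^sub>E J A)"
    if U: "(\<lambda>\<omega> k. U k \<omega>) \<in> K \<rightarrow>\<^sub>M path_space" and J: "finite J"
    for K :: "'c measure" and U :: "nat \<Rightarrow> 'c \<Rightarrow> 'r" and J A
  proof -
    have comp: "(\<lambda>\<omega>. U k \<omega>) \<in> K \<rightarrow>\<^sub>M count_space UNIV" for k
      using measurable_compose[OF U path_space_component[of k]] .
    have "(\<lambda>\<omega>. \<lambda>n\<in>J. U n \<omega>) \<in> K \<rightarrow>\<^sub>M Pi\<^sub>M J (\<lambda>_. count_space UNIV)"
      by (intro measurable_restrict comp)
    moreover have "Pi\<^sub>E J A \<in> sets (Pi\<^sub>M J (\<lambda>_. count_space (UNIV :: 'r set)))"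
      using J by (intro sets_PiM_I_finite) auto
    moreover have "prod_emb UNIV (\<lambda>_. count_space UNIV) J (Pi\<^sub>E J A) \<in> sets path_space"
      using J by (intro sets_PiM_I) auto
    moreover have "(\<lambda>\<omega> k. U k \<omega>) -` prod_emb UNIV (\<lambda>_. count_space UNIV) J (Pi\<^sub>E J A) =
        (\<lambda>\<omega>. \<lambda>n\<in>J. U n \<omega>) -` Pi\<^sub>E J A"
      by (auto simp: prod_emb_def restrict_def)
    ultimately show ?thesis using U by (simp add: emeasure_distr)
  qed
  show ?thesis
  proof (rule measure_eqI_PiM_infinite)
    have "prob_space M" using Y by (simp add: discrete_process_def)
    then interpret prob_space "distr M path_space (\<lambda>\<omega> k. Y k \<omega>)" by (rule prob_space.prob_space_distr[OF _ path(1)])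
    show "finite_measure (distr M path_space (\<lambda>\<omega> k. Y k \<omega>))" by (rule finite_measure_axioms)
    fix A :: "nat \<Rightarrow> 'r set" and J :: "nat set" assume J: "finite J"
    then have "distr M (Pi\<^sub>M J (\<lambda>_. count_space UNIV)) (\<lambda>\<omega>. \<lambda>n\<in>J. Y n \<omega>) =
        distr N (Pi\<^sub>M J (\<lambda>_. count_space UNIV)) (\<lambda>\<omega>. \<lambda>n\<in>J. Z n \<omega>)"
      using fdd by (simp add: same_finite_dim_distributions_def)
    then show "emeasure (distr M path_space (\<lambda>\<omega> k. Y k \<omega>)) (prod_emb UNIV (\<lambda>_. count_space UNIV) J (Pi\<^sub>E J A)) =
        emeasure (distr N path_space (\<lambda>\<omega> k. Z k \<omega>)) (prod_emb UNIV (\<lambda>_. count_space UNIV) J (Pi\<^sub>E J A))"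
      unfolding emb[OF path(1) J] emb[OF path(2) J] by (simp only:)
  qed simp_all
qed

section \<open>The row of the successors array\<close>

lemma (in markov_path_law) visit_successor_chain:
  "homogeneous_markov_chain L 1 (\<lambda>n. visit_successor D (n - 1))"
  unfolding homogeneous_markov_chain_def
proof (intro conjI exI[of _ "visit_kernel Q D"] allI impI)
  show "discrete_process L 1 (\<lambda>n. visit_successor D (n - 1))"
    using prob_space_axioms by (simp add: discrete_process_def)
  fix n x x' assume n: "1 \<le> n"
    and pos: "\<P>(u in L. \<forall>k\<in>{1..n}. visit_successor D (k - 1) u = x k) > 0"
  obtain m where m: "n = Suc m" using n by (cases n) auto
  \<comment> \<open>Reindexes the past from counting at 1 to counting at 0 and appends the next
    state \<open>x'\<close>, so that both events become cylinders of
    \<open>visit_successor\<close>.\<close>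
  define a where "a k = (if k = Suc m then x' else x (Suc k))" for k
  have past: "(\<forall>k\<in>{1..n}. visit_successor D (k - 1) u = x k) \<longleftrightarrow> (\<forall>k\<le>m. visit_successor D k u = a k)" for u
  proof -
    have "{1..n} = Suc ` {..m}" unfolding m by (auto simp: image_iff Suc_le_eq gr0_conv_Suc)
    then show ?thesis by (auto simp: a_def simp del: visit_successor.simps)
  qed
  have "(visit_successor D (Suc n - 1) u = x' \<and> (\<forall>k\<le>m. visit_successor D k u = a k)) \<longleftrightarrow>
      (\<forall>k\<le>Suc m. visit_successor D k u = a k)" for u
    unfolding m by (auto simp: le_Suc_eq a_def simp del: visit_successor.simps)
  then show "\<P>(u in L. visit_successor D (Suc n - 1) u = x' \<bar> \<forall>k\<in>{1..n}. visit_successor D (k - 1) u = x k) =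
      pmf (visit_kernel Q D (x n)) x'"
    using pos visit_successor_markov[OF law, of m D a]
    unfolding cond_prob_def past by (simp add: a_def m)
qed

lemma (in markov_path_law) recurrent_visit_successor_chain:
  assumes rec: "AE u in L. \<forall>w. visit_successor D 0 u = Some w \<longrightarrow> infinite {n. visit_successor D n u = Some w}"
  shows "recurrent_chain L 1 (\<lambda>n. visit_successor D (n - 1))"
  unfolding recurrent_chain_def
proof (intro allI impI)
  fix x assume pos: "\<P>(u in L. visit_successor D (1 - 1) u = x) > 0"
  have shift: "infinite {n. 1 \<le> n \<and> visit_successor D (n - 1) u = x} \<longleftrightarrow> infinite {n. visit_successor D n u = x}" for u
    using infinite_Suc_iff[of "\<lambda>n. 1 \<le> n \<and> visit_successor D (n - 1) u = x"] by simp
  have [measurable]: "Measurable.pred path_space (\<lambda>u. infinite {n. visit_successor D n u = x})"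
    unfolding infinite_nat_iff_unbounded_le mem_Collect_eq by measurable
  have "AE u in L. visit_successor D 0 u = x \<longrightarrow> infinite {n. visit_successor D n u = x}"
  proof (cases x)
    case None
    \<comment> \<open>With no first visit every later entry is \<open>None\<close> as well, so the
      extra state recurs trivially.\<close>
    have "infinite {n. visit_successor D n u = None}" if "visit_successor D 0 u = None" for u
    proof -
      have "\<nexists>k. u k \<in> D" using that by (auto split: if_splits)
      then show ?thesis using visit_successor_None[of u D] by simp
    qed
    then show ?thesis using None by (auto simp del: visit_successor.simps)
  next
    case (Some w)
    then show ?thesis using rec by (auto simp del: visit_successor.simps)
  qed
  then have "prob {u \<in> space L. infinite {n. visit_successor D n u = x} \<and> visit_successor D 0 u = x} =
      prob {u \<in> space L. visit_successor D 0 u = x}"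
    by (intro measure_eq_AE) (auto simp: pred_sets simp del: visit_successor.simps)
  then show "\<P>(u in L. infinite {n. 1 \<le> n \<and> visit_successor D (n - 1) u = x} \<bar> visit_successor D (1 - 1) u = x) = 1"
    unfolding cond_prob_def shift using pos by (simp del: visit_successor.simps)
qed

theorem proposition3p1:
  fixes M :: "'a measure" and Y :: "nat \<Rightarrow> 'a \<Rightarrow> 's::countable"
  assumes "recurrent_hidden_markov_model M 0 Y"
  shows "\<forall>y. recurrent_hidden_markov_model M 1 (successors_array Y y)"
proof
  fix y
  obtain N :: "(nat \<Rightarrow> nat \<times> 's) measure" and X :: "nat \<Rightarrow> _ \<Rightarrow> nat" and Z where
    Y: "discrete_process M 0 Y" and pair: "hidden_markov_pair N 0 X Z"
    and rec: "recurrent_chain N 0 X" and fdd: "same_finite_dim_distributions 0 M Y N Z"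
    using assms unfolding recurrent_hidden_markov_model_def by blast
  have X: "discrete_process N 0 X" and Z: "discrete_process N 0 Z"
    using pair by (auto simp: hidden_markov_pair_def homogeneous_markov_chain_def)
  obtain K f where law: "markov_law (pair_kernel K f) (distr N path_space (pair_path X Z))"
    and path: "pair_path X Z \<in> N \<rightarrow>\<^sub>M path_space"
    using hidden_markov_pair_law[OF pair] by blast
  define L where "L = distr N path_space (pair_path X Z)"
  interpret markov_path_law "pair_kernel K f" L by standard (use law in \<open>simp add: L_def\<close>)
  let ?D = "{w :: 's option \<times> nat. fst w = Some y}"
  let ?U = "\<lambda>n. visit_successor ?D (n - 1)"
  \<comment> \<open>\<open>?U\<close> is the hidden chain and \<open>?R\<close> its read-out, the
    value of \<open>Z\<close> stored in the successor pair.\<close>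
  let ?R = "\<lambda>n u. Option.bind (?U n u) fst"
  have succ: "successors_array W y n \<omega> = visit_successor {y} (n - 1) (\<lambda>k. W k \<omega>)"
    if "1 \<le> n" for n and W :: "nat \<Rightarrow> 'b \<Rightarrow> 's" and \<omega>
    using that by (cases n) (simp_all add: successors_array_def successor_eq_visit_successor)
  have Ypath: "(\<lambda>\<omega> k. Y k \<omega>) \<in> M \<rightarrow>\<^sub>M path_space"
    and Zpath: "(\<lambda>\<omega> k. Z k \<omega>) \<in> N \<rightarrow>\<^sub>M path_space"
    using Y Z by (auto intro!: measurable_into_path_space simp: discrete_process_def)
  \<comment> \<open>The hidden component recurs by assumption, and it alone governs the transitions
    of the pair; hence the choice of \<open>snd\<close> for \<open>g\<close>.\<close>
  have "AE u in L. \<forall>w. visit_successor ?D 0 u = Some w \<longrightarrow> infinite {n. visit_successor ?D n u = Some w}"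
  proof (rule AE_visit_successor_recurrent[where g = snd])
    show "pair_kernel K f w = pair_kernel K f w'" if "snd w = snd w'" for w w'
      using that by (simp add: pair_kernel_def)
    have "{u :: nat \<Rightarrow> 's option \<times> nat. infinite {n. snd (u n) = snd (u 0)}} \<in> sets path_space"
    proof (rule pred_sets)
      have [measurable]: "(\<lambda>u :: nat \<Rightarrow> 's option \<times> nat. snd (u n)) \<in> path_space \<rightarrow>\<^sub>M count_space UNIV" for n
        by (rule measurable_compose[OF path_space_component]) simp
      show "Measurable.pred path_space (\<lambda>u :: nat \<Rightarrow> 's option \<times> nat. infinite {n. snd (u n) = snd (u 0)})"
        unfolding infinite_nat_iff_unbounded_le mem_Collect_eq by measurable
    qed
    then show "AE u in L. infinite {n. snd (u n) = snd (u 0)}"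
      unfolding L_def using recurrent_chain_AE[OF X rec] by (subst AE_distr_iff[OF path]) (auto simp: pair_path_def)
    have "{u. u 0 \<notin> ?D} \<in> sets path_space" by (rule pred_sets) measurable
    then show "AE u in L. u 0 \<notin> ?D"
      unfolding L_def by (subst AE_distr_iff[OF path]) (auto simp: pair_path_def)
  qed
  then have "recurrent_chain L 1 ?U" by (rule recurrent_visit_successor_chain)
  moreover have "hidden_markov_pair L 1 ?U ?R"
    by (rule hidden_markov_pair_function[OF visit_successor_chain])
  moreover have "discrete_process M 1 (successors_array Y y)"
    unfolding discrete_process_def
  proof (intro conjI allI impI)
    fix n :: nat assume "1 \<le> n"
    then have "successors_array Y y n = (\<lambda>\<omega>. visit_successor {y} (n - 1) (\<lambda>k. Y k \<omega>))"
      by (intro ext) (rule succ)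
    then show "successors_array Y y n \<in> M \<rightarrow>\<^sub>M count_space UNIV"
      using measurable_compose[OF Ypath visit_successor_measurable] by simp
  qed (use Y in \<open>simp add: discrete_process_def\<close>)
  moreover have "same_finite_dim_distributions 1 M (successors_array Y y) L ?R"
    unfolding same_finite_dim_distributions_def
  proof (intro allI impI)
    fix J :: "nat set" assume J: "finite J \<and> J \<subseteq> {1..}"
    let ?P = "Pi\<^sub>M J (\<lambda>_. count_space UNIV) :: (nat \<Rightarrow> 's option) measure"
    let ?V = "\<lambda>u. \<lambda>n\<in>J. visit_successor {y} (n - 1) u"
    have V: "?V \<in> path_space \<rightarrow>\<^sub>M ?P" by (intro measurable_restrict) simp
    have R: "(\<lambda>u. \<lambda>n\<in>J. ?R n u) \<in> path_space \<rightarrow>\<^sub>M ?P"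
      by (intro measurable_restrict measurable_compose[OF visit_successor_measurable]) simp
    \<comment> \<open>The row is a functional of the whole path, so equality in law passes from
      \<open>Y\<close> to \<open>Z\<close>, where the row is a function of the pair chain.\<close>
    have "(\<lambda>\<omega>. \<lambda>n\<in>J. successors_array Y y n \<omega>) = ?V \<circ> (\<lambda>\<omega> k. Y k \<omega>)"
    proof (intro ext)
      fix \<omega> n
      have "1 \<le> n" if "n \<in> J" using J that by auto
      then show "(\<lambda>n\<in>J. successors_array Y y n \<omega>) n = (?V \<circ> (\<lambda>\<omega> k. Y k \<omega>)) \<omega> n"
        by (simp add: succ del: One_nat_def)
    qed
    then have "distr M ?P (\<lambda>\<omega>. \<lambda>n\<in>J. successors_array Y y n \<omega>) = distr (distr M path_space (\<lambda>\<omega> k. Y k \<omega>)) ?P ?V"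
      by (simp only: distr_distr[OF V Ypath])
    also have "\<dots> = distr N ?P (?V \<circ> (\<lambda>\<omega> k. Z k \<omega>))"
      unfolding path_law_eqI[OF Y Z fdd] by (rule distr_distr[OF V Zpath])
    also have "?V \<circ> (\<lambda>\<omega> k. Z k \<omega>) = (\<lambda>u. \<lambda>n\<in>J. ?R n u) \<circ> pair_path X Z"
      by (simp add: fun_eq_iff visit_successor_pair_path)
    also have "distr N ?P \<dots> = distr L ?P (\<lambda>u. \<lambda>n\<in>J. ?R n u)"
      unfolding L_def by (rule distr_distr[OF R path, symmetric])
    finally show "distr M ?P (\<lambda>\<omega>. \<lambda>n\<in>J. successors_array Y y n \<omega>) = distr L ?P (\<lambda>u. \<lambda>n\<in>J. ?R n u)" .
  qed
  ultimately show "recurrent_hidden_markov_model M 1 (successors_array Y y)"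
    by (intro recurrent_hidden_markov_modelI)
qed

end
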